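(* Let $w$ be a function on $[-1,1]$ for which there are constants $m,R>0$ with $w(x)\ge m$ for every $-1\le x\le 1$ and $|w(x)-w(y)|\le R\,(y-x)$ for every $-1\le x<y\le 1$. Then there exists a constant $C(w)>0$ depending only on $w$ (in particular independent of $n$ and $x$) such that for every integer $n\ge 1$ and every point $x\in(-1,1)$ at which $\pi$ is differentiable, $$-C(w)\frac{\lambda(x)}{1-x}\le \pi'(x)-w(x)\le C(w)\,\lambda(x)\min\left\{\frac{1}{1+x},\,n^2\right\}.$$
   Context: Fix an integer $n\ge1$. Let $\mathcal{M}_n$ be the set of positive Borel measures $\mu$ on $[-1,1]$ such that $\int_{-1}^1 p(t)w(t)\,dt=\int p\,d\mu$ for every polynomial $p$ of degree at most $2n-1$. For $-1\le x\le 1$ define $\pi(x):=\sup_{\mu\in\mathcal{M}_n}\mu([-1,x])$ and $\lambda(x):=\sup_{\mu\in\mathcal{M}_n}\mu(\{x\})$. (Both depend on $n$ and $w$.) *)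

theory Defs
  imports "HOL-Analysis.Analysis" "HOL-Computational_Algebra.Polynomial"
begin

definition moment_measures :: "(real \<Rightarrow> real) \<Rightarrow> nat \<Rightarrow> real measure set" where
  "moment_measures w n =
     {\<mu>. sets \<mu> = sets (borel :: real measure) \<and>
          emeasure \<mu> (- {-1..1}) = 0 \<and>
          (\<forall>p :: real poly. degree p \<le> 2 * n - 1 \<longrightarrow>
              integrable \<mu> (poly p) \<and>
              (\<integral>t. poly p t \<partial>\<mu>) = integral {-1..1} (\<lambda>t. poly p t * w t))}"

definition pi_fun :: "(real \<Rightarrow> real) \<Rightarrow> nat \<Rightarrow> real \<Rightarrow> real" where
  "pi_fun w n x = Sup ((\<lambda>\<mu>. measure \<mu> {-1..x}) ` moment_measures w n)"

definition lambda_fun :: "(real \<Rightarrow> real) \<Rightarrow> nat \<Rightarrow> real \<Rightarrow> real" where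
  "lambda_fun w n x = Sup ((\<lambda>\<mu>. measure \<mu> {x}) ` moment_measures w n)"

end

theory Submission
  imports Defs
begin

text \<open>For fixed \<open>x\<close>, minimising \<open>\<integral> K w\<close> over polynomials \<open>K \<ge> 0\<close> with \<open>K x \<ge> 1\<close> yields a positive quadrature
  with a node at \<open>x\<close> that attains \<open>\<pi>(x)\<close>. Hermite interpolation of a step at its nodes gives a majorant \<open>P\<close> of
  the indicator of \<open>[-1,x]\<close> with \<open>\<integral> P w = \<pi>(x)\<close>, and \<open>\<integral> P w - \<integral>\<^bsub>[-1,x]\<^esub> w \<le> \<lambda>(x)\<close> because the quadrature is
  extremal from both sides. Composing \<open>P\<close> with a dilation fixing an endpoint \<open>e = \<plusminus>1\<close> gives a competitor at
  nearby points; comparing it with the same dilation of the indicator, the Lipschitz bound leaves an error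
  proportional to \<open>\<integral> P w - \<integral>\<^bsub>[-1,x]\<^esub> w\<close>, so that \<open>(x - e) (\<pi>'(x) - w(x)) \<le> (1 + 2R/m) \<lambda>(x)\<close>. For
  \<open>1 + x \<le> 1/(2n\<^sup>2)\<close> one adds to \<open>P\<close> a small multiple of the polynomial that carries the mass at \<open>x\<close>: this
  gives \<open>\<pi>'(x) \<le> 2 L \<lambda>(x)\<close> with \<open>L\<close> a Lipschitz constant of \<open>P\<close>, where \<open>L = O(n\<^sup>4 \<integral> P) = O(n\<^sup>2)\<close> by a Markov
  inequality and a test polynomial of Fejer type.\<close>

section \<open>Chebyshev polynomials and a Markov inequality\<close>

fun cheb_T :: "nat \<Rightarrow> real poly" where
  "cheb_T 0 = 1"
| "cheb_T (Suc 0) = [:0, 1:]"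
| "cheb_T (Suc (Suc k)) = [:0, 2:] * cheb_T (Suc k) - cheb_T k"

text \<open>Built from \<open>cheb_T\<close> rather than by the usual three-term recursion, so that
  degree and Lipschitz estimates for first-kind polynomials carry over by addition alone.\<close>

fun cheb_U :: "nat \<Rightarrow> real poly" where
  "cheb_U 0 = 1"
| "cheb_U (Suc 0) = [:0, 2:]"
| "cheb_U (Suc (Suc k)) = cheb_U k + smult 2 (cheb_T (Suc (Suc k)))"

lemma poly_cheb_T_cos: "poly (cheb_T k) (cos a) = cos (real k * a)"
proof (induction k rule: cheb_T.induct)
  case (3 k)
  have "2 * cos a * cos (real (Suc k) * a) = cos (real k * a) + cos (real (Suc (Suc k)) * a)"
    using cos_times_cos[of "real (Suc k) * a" a] by (simp add: algebra_simps)
  with 3 show ?case by (simp add: algebra_simps)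
qed auto

lemma poly_cheb_U_cos: "poly (cheb_U k) (cos a) * sin a = sin (real (Suc k) * a)"
proof (induction k rule: cheb_U.induct)
  case 2
  then show ?case using sin_double[of a] by simp
next
  case (3 k)
  have "2 * cos (real (Suc (Suc k)) * a) * sin a
      = sin (real (Suc (Suc (Suc k))) * a) - sin (real (Suc k) * a)"
    using cos_times_sin[of "real (Suc (Suc k)) * a" a] by (simp add: algebra_simps)
  moreover have "poly (cheb_U (Suc (Suc k))) (cos a)
      = poly (cheb_U k) (cos a) + 2 * cos (real (Suc (Suc k)) * a)"
    using poly_cheb_T_cos[of "Suc (Suc k)" a] by (simp del: cheb_T.simps)
  ultimately show ?case
    using 3 by (simp only: distrib_right)
qed auto

lemma cheb_T_bound: "\<bar>poly (cheb_T k) t\<bar> \<le> 1" if "t \<in> {-1..1}"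
  using poly_cheb_T_cos[of k "arccos t"] that by (simp add: cos_arccos)

lemma abs_sin_mult_le: "\<bar>sin (real k * a)\<bar> \<le> real k * \<bar>sin a\<bar>"
proof (induction k)
  case (Suc k)
  have "\<bar>sin (real (Suc k) * a)\<bar> \<le> \<bar>sin (real k * a) * cos a\<bar> + \<bar>cos (real k * a) * sin a\<bar>"
    by (simp add: distrib_right sin_add algebra_simps)
  also have "\<dots> \<le> \<bar>sin (real k * a)\<bar> * 1 + 1 * \<bar>sin a\<bar>"
    unfolding abs_mult by (intro add_mono mult_mono) auto
  finally show ?case using Suc by (simp add: algebra_simps)
qed auto

text \<open>With both points written as cosines, the difference of values factors into two sines of
  k-fold angles. Each is at most k times the sine of the single angle, and the product of the single
  sines is again a difference of cosines.\<close>

lemma cheb_T_lipschitz: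
  assumes "s \<in> {-1..1}" "t \<in> {-1..1}"
  shows "\<bar>poly (cheb_T k) s - poly (cheb_T k) t\<bar> \<le> real k ^ 2 * \<bar>s - t\<bar>"
proof -
  define a b where "a = arccos s" and "b = arccos t"
  have ab: "cos a = s" "cos b = t" using assms by (auto simp: a_def b_def cos_arccos)
  have "\<bar>cos (real k * a) - cos (real k * b)\<bar>
      = 2 * (\<bar>sin (real k * ((a + b) / 2))\<bar> * \<bar>sin (real k * ((b - a) / 2))\<bar>)"
    by (simp add: cos_diff_cos abs_mult algebra_simps)
  also have "\<dots> \<le> 2 * ((real k * \<bar>sin ((a + b) / 2)\<bar>) * (real k * \<bar>sin ((b - a) / 2)\<bar>))"
    by (intro mult_left_mono mult_mono abs_sin_mult_le) auto
  also have "\<dots> = real k ^ 2 * \<bar>cos a - cos b\<bar>"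
    by (simp add: cos_diff_cos abs_mult power2_eq_square)
  finally show ?thesis
    using poly_cheb_T_cos[of k a] poly_cheb_T_cos[of k b] ab by simp
qed

text \<open>Passing from k to k + 2 adds a term with Lipschitz constant 2 (k + 2)^2, so a cubic
  bound survives the induction.\<close>

lemma cheb_U_lipschitz:
  assumes "s \<in> {-1..1}" "t \<in> {-1..1}"
  shows "\<bar>poly (cheb_U k) s - poly (cheb_U k) t\<bar> \<le> real (Suc k) ^ 3 * \<bar>s - t\<bar>"
proof (induction k rule: cheb_U.induct)
  case 2
  have "poly (cheb_U (Suc 0)) s - poly (cheb_U (Suc 0)) t = 2 * (s - t)" by simp
  then show ?case by (simp only: abs_mult) simp
next
  case (3 k)
  have "poly (cheb_U (Suc (Suc k))) s - poly (cheb_U (Suc (Suc k))) t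
     = (poly (cheb_U k) s - poly (cheb_U k) t)
       + 2 * (poly (cheb_T (Suc (Suc k))) s - poly (cheb_T (Suc (Suc k))) t)"
    by (simp del: cheb_T.simps)
  also have "\<bar>\<dots>\<bar> \<le> real (Suc k) ^ 3 * \<bar>s - t\<bar> + 2 * (real (Suc (Suc k)) ^ 2 * \<bar>s - t\<bar>)"
    using 3 cheb_T_lipschitz[OF assms, of "Suc (Suc k)"]
    by (intro order.trans[OF abs_triangle_ineq] add_mono) (simp_all only: abs_mult abs_numeral mult_le_cancel_left_pos zero_less_numeral)
  also have "\<dots> = (real (Suc k) ^ 3 + 2 * real (Suc (Suc k)) ^ 2) * \<bar>s - t\<bar>"
    by (simp only: distrib_right mult.assoc)
  also have "\<dots> \<le> real (Suc (Suc (Suc k))) ^ 3 * \<bar>s - t\<bar>"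
    by (intro mult_right_mono) (auto simp: power2_eq_square power3_eq_cube algebra_simps)
  finally show ?case .
qed auto

text \<open>The second conjunct is shifted by one because the leading coefficient of T_0 does not
  follow the pattern of the others.\<close>

lemma cheb_T_coeff:
  "degree (cheb_T k) \<le> k \<and> coeff (cheb_T (Suc k)) (Suc k) = 2 ^ k"
proof (induction k rule: cheb_T.induct)
  case (3 k)
  have "degree ([:0, 2:] * cheb_T (Suc k)) \<le> Suc (Suc k)"
    using 3 degree_mult_le[of "[:0, 2:]" "cheb_T (Suc k)"] by simp
  moreover have "degree (cheb_T k) \<le> Suc (Suc k)" using 3 by simp
  ultimately have d: "degree (cheb_T (Suc (Suc k))) \<le> Suc (Suc k)"
    by (simp add: degree_diff_le)
  have "coeff (cheb_T (Suc k)) (Suc (Suc (Suc k))) = 0"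
    using 3 by (intro coeff_eq_0) auto
  then have "coeff (cheb_T (Suc (Suc (Suc k)))) (Suc (Suc (Suc k)))
      = 2 * coeff (cheb_T (Suc (Suc k))) (Suc (Suc k))"
    by (simp del: cheb_T.simps(3) add: cheb_T.simps(3)[of "Suc k"])
  with 3 d show ?case by simp
qed (auto simp: numeral_2_eq_2)

lemma cheb_U_degree: "degree (cheb_U k) \<le> k" and cheb_U_coeff: "coeff (cheb_U k) k = 2 ^ k"
proof -
  have "degree (cheb_U k) \<le> k \<and> coeff (cheb_U k) k = 2 ^ k"
  proof (induction k rule: cheb_U.induct)
    case (3 k)
    have "degree (cheb_U k) \<le> Suc (Suc k)" "coeff (cheb_U k) (Suc (Suc k)) = 0"
      using 3 by (auto intro: coeff_eq_0)
    moreover have "degree (smult 2 (cheb_T (Suc (Suc k)))) \<le> Suc (Suc k)"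
      using cheb_T_coeff[of "Suc (Suc k)"] by simp
    ultimately show ?case
      using cheb_T_coeff[of "Suc k"] by (simp add: degree_add_le del: cheb_T.simps)
  qed auto
  then show "degree (cheb_U k) \<le> k" "coeff (cheb_U k) k = 2 ^ k" by auto
qed

lemma cheb_U_span:
  "degree p < N \<Longrightarrow> \<exists>b. p = (\<Sum>k<N. smult (b k) (cheb_U k))"
proof (induction N arbitrary: p)
  case (Suc N)
  define c where "c = coeff p N / 2 ^ N"
  define q where "q = p - smult c (cheb_U N)"
  have q: "degree q \<le> N" "coeff q N = 0"
    using Suc.prems cheb_U_degree[of N]
    by (auto simp: q_def c_def cheb_U_coeff intro!: degree_diff_le order.trans[OF degree_smult_le])
  have "\<exists>b. q = (\<Sum>k<N. smult (b k) (cheb_U k))"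
  proof (cases "N = 0")
    case True
    then have "q = 0" using q by (metis leading_coeff_0_iff le_zero_eq)
    then show ?thesis using True by simp
  next
    case False
    have "degree q < N"
      using q False by (metis leading_coeff_0_iff le_neq_implies_less degree_0 neq0_conv)
    then show ?thesis by (rule Suc.IH)
  qed
  then obtain b where b: "q = (\<Sum>k<N. smult (b k) (cheb_U k))" by blast
  have "p = (\<Sum>k<Suc N. smult ((b(N := c)) k) (cheb_U k))"
    using b by (simp add: q_def diff_eq_eq)
  then show ?case by blast
qed auto

section \<open>Fourier coefficients with respect to the second-kind polynomials\<close>

lemma has_integral_cos_mult:
  assumes "k \<noteq> 0"
  shows "((\<lambda>a. cos (real_of_int k * a)) has_integral 0) {0..pi}"
proof -
  have "((\<lambda>a. cos (real_of_int k * a)) has_integral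
      (sin (real_of_int k * pi) / real_of_int k - sin (real_of_int k * 0) / real_of_int k)) {0..pi}"
    using assms
    by (intro fundamental_theorem_of_calculus)
      (auto intro!: derivative_eq_intros simp flip: has_real_derivative_iff_has_vector_derivative)
  moreover have "sin (real_of_int k * pi) = 0"
    using sin_int_times_real by (metis mult.commute sin_npi_int)
  ultimately show ?thesis by simp
qed

lemma has_integral_sin_times_sin:
  "((\<lambda>a. sin (real (Suc j) * a) * sin (real (Suc k) * a)) has_integral (if j = k then pi / 2 else 0)) {0..pi}"
proof -
  define d where "d = int j - int k"
  define e where "e = int j + int k + 2"
  have e: "e \<noteq> 0" by (simp add: e_def)
  have *: "sin (real (Suc j) * a) * sin (real (Suc k) * a)
      = (cos (real_of_int d * a) - cos (real_of_int e * a)) / 2" for a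
    unfolding sin_times_sin by (simp add: d_def e_def algebra_simps)
  have "((\<lambda>a. cos (real_of_int d * a)) has_integral (if j = k then pi else 0)) {0..pi}"
    using has_integral_cos_mult[of d] has_integral_const_real[of "1::real" 0 pi]
    by (auto simp: d_def)
  from has_integral_divide[OF has_integral_diff[OF this has_integral_cos_mult[OF e]], of 2]
  show ?thesis unfolding * by (auto split: if_splits)
qed

text \<open>For an antiderivative \<open>g\<close> of \<open>f\<close>, the function
  \<open>- g (cos a)\<close> has the integrand as its derivative; the minus sign undoes the reversal
  of orientation by the cosine.\<close>

lemma has_integral_cos_substitution:
  fixes f :: "real \<Rightarrow> real"
  assumes "continuous_on {-1..1} f"
  shows "((\<lambda>a. f (cos a) * sin a) has_integral integral {-1..1} f) {0..pi}"
proof -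
  obtain g where g: "\<And>x. x \<in> {-1..1} \<Longrightarrow> (g has_vector_derivative f x) (at x within {-1..1})"
    using antiderivative_continuous[OF assms] by blast
  have "((\<lambda>a. - g (cos a)) has_vector_derivative f (cos a) * sin a) (at a within {0..pi})"
    if "a \<in> {0..pi}" for a
  proof -
    have "(g has_vector_derivative f (cos a)) (at (cos a) within cos ` {0..pi})"
      by (rule has_vector_derivative_within_subset[OF g]) auto
    moreover have "(cos has_vector_derivative - sin a) (at a within {0..pi})"
      by (auto intro!: derivative_eq_intros simp flip: has_real_derivative_iff_has_vector_derivative)
    ultimately have "(g \<circ> cos has_vector_derivative - sin a *\<^sub>R f (cos a)) (at a within {0..pi})"
      by (intro vector_diff_chain_within)
    from has_vector_derivative_minus[OF this] show ?thesis by (simp add: o_def mult.commute)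
  qed
  then have "((\<lambda>a. f (cos a) * sin a) has_integral (- g (cos pi) - - g (cos 0))) {0..pi}"
    by (intro fundamental_theorem_of_calculus) auto
  moreover have "(f has_integral (g 1 - g (-1))) {-1..1}"
    by (intro fundamental_theorem_of_calculus g) auto
  ultimately show ?thesis by (simp add: integral_unique)
qed

text \<open>On \<open>[-1,1]\<close> the weight \<open>sqrt (1 - t\<^sup>2)\<close> compensates the growth of the second-kind polynomials, so
  that their Fourier coefficients are controlled by the unweighted integral.\<close>

lemma cheb_U_coefficient_bound:
  assumes "\<And>t. t \<in> {-1..1} \<Longrightarrow> poly (\<Sum>k<N. smult (b k) (cheb_U k)) t \<ge> 0" and "j < N"
  shows "\<bar>b j\<bar> \<le> integral {-1..1} (poly (\<Sum>k<N. smult (b k) (cheb_U k)))"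
proof -
  define p where "p = (\<Sum>k<N. smult (b k) (cheb_U k))"
  have p: "poly p (cos a) * sin a = (\<Sum>k<N. b k * sin (real (Suc k) * a))" for a
    by (simp add: p_def poly_sum sum_distrib_right poly_cheb_U_cos mult.assoc del: of_nat_Suc)
  have "((\<lambda>a. \<Sum>k<N. b k * (sin (real (Suc k) * a) * sin (real (Suc j) * a))) has_integral
      (\<Sum>k<N. b k * (if k = j then pi / 2 else 0))) {0..pi}"
    by (intro has_integral_sum has_integral_mult_right has_integral_sin_times_sin) auto
  moreover have "(\<Sum>k<N. b k * (if k = j then pi / 2 else 0)) = b j * (pi / 2)"
    using assms(2) by (simp add: if_distrib sum.delta cong: if_cong)
  moreover have "(\<Sum>k<N. b k * (sin (real (Suc k) * a) * sin (real (Suc j) * a)))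
      = poly p (cos a) * sin a * sin (real (Suc j) * a)" for a
    unfolding p sum_distrib_right by (simp add: mult.assoc)
  ultimately have 1: "((\<lambda>a. poly p (cos a) * sin a * sin (real (Suc j) * a)) has_integral b j * (pi / 2)) {0..pi}"
    by simp
  have 2: "((\<lambda>a. poly p (cos a) * sin a) has_integral integral {-1..1} (poly p)) {0..pi}"
    by (intro has_integral_cos_substitution continuous_intros)
  have "norm (integral {0..pi} (\<lambda>a. poly p (cos a) * sin a * sin (real (Suc j) * a)))
     \<le> integral {0..pi} (\<lambda>a. poly p (cos a) * sin a)"
  proof (rule integral_norm_bound_integral)
    fix a :: real assume a: "a \<in> {0..pi}"
    have "poly p (cos a) * sin a \<ge> 0"
      using a assms(1)[of "cos a"] by (auto simp: p_def sin_ge_zero)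
    then show "norm (poly p (cos a) * sin a * sin (real (Suc j) * a)) \<le> poly p (cos a) * sin a"
      using mult_left_mono[of "\<bar>sin (real (Suc j) * a)\<bar>" 1 "poly p (cos a) * sin a"]
      by (simp only: real_norm_def abs_mult[of _ "sin (real (Suc j) * a)"]) (auto simp del: of_nat_Suc)
  qed (use 1 2 in blast)+
  then have "\<bar>b j * (pi / 2)\<bar> \<le> integral {-1..1} (poly p)"
    using 1 2 by (simp add: integral_unique)
  moreover have "\<bar>b j\<bar> * 1 \<le> \<bar>b j\<bar> * (pi / 2)"
    using pi_gt3 by (intro mult_left_mono) auto
  ultimately show ?thesis by (simp add: p_def abs_mult)
qed

text \<open>A Markov inequality in which nonnegativity makes the integral the L1 norm: there are N
  coefficients, each at most the integral, and every basis polynomial has Lipschitz constant at most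
  N^3.\<close>

lemma poly_lipschitz_integral:
  fixes N :: nat
  assumes "degree p < N" and nn: "\<And>t. t \<in> {-1..1} \<Longrightarrow> poly p t \<ge> 0"
    and st: "s \<in> {-1..1}" "t \<in> {-1..1}"
  shows "\<bar>poly p s - poly p t\<bar> \<le> real N ^ 4 * integral {-1..1} (poly p) * \<bar>s - t\<bar>"
proof -
  obtain b where b: "p = (\<Sum>k<N. smult (b k) (cheb_U k))"
    using cheb_U_span[OF assms(1)] by blast
  define I where "I = integral {-1..1} (poly p)"
  have bI: "\<bar>b k\<bar> \<le> I" if "k < N" for k
    using cheb_U_coefficient_bound[where N = N and b = b and j = k] that nn unfolding I_def b by blast
  have "\<bar>poly p s - poly p t\<bar> = \<bar>\<Sum>k<N. b k * (poly (cheb_U k) s - poly (cheb_U k) t)\<bar>"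
    unfolding b by (simp add: poly_sum right_diff_distrib sum_subtractf)
  also have "\<dots> \<le> (\<Sum>k<N. \<bar>b k\<bar> * \<bar>poly (cheb_U k) s - poly (cheb_U k) t\<bar>)"
    by (rule order.trans[OF sum_abs]) (simp add: abs_mult)
  also have "\<dots> \<le> (\<Sum>k<N. I * (real N ^ 3 * \<bar>s - t\<bar>))"
  proof (intro sum_mono mult_mono bI)
    fix k assume k: "k \<in> {..<N}"
    have "\<bar>poly (cheb_U k) s - poly (cheb_U k) t\<bar> \<le> real (Suc k) ^ 3 * \<bar>s - t\<bar>"
      by (rule cheb_U_lipschitz[OF st])
    also have "\<dots> \<le> real N ^ 3 * \<bar>s - t\<bar>"
      using k by (intro mult_right_mono power_mono) auto
    finally show "\<bar>poly (cheb_U k) s - poly (cheb_U k) t\<bar> \<le> real N ^ 3 * \<bar>s - t\<bar>" .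
    show "0 \<le> I" using bI[of k] k by auto
  qed auto
  also have "\<dots> = real N ^ 4 * I * \<bar>s - t\<bar>"
    by (simp add: power4_eq_xxxx power3_eq_cube)
  finally show ?thesis unfolding I_def .
qed

section \<open>Step majorants by Hermite interpolation\<close>

text \<open>Polynomials with nonnegative Newton coefficients at the given nodes, in Horner form.\<close>

fun newton_cone :: "real list \<Rightarrow> real poly set" where
  "newton_cone [] = {0}"
| "newton_cone (\<xi> # \<xi>s) = {[:c:] + [:-\<xi>, 1:] * B | c B. c \<ge> 0 \<and> B \<in> newton_cone \<xi>s}"

definition node_poly :: "real list \<Rightarrow> real poly" where
  "node_poly \<xi>s = prod_list (map (\<lambda>\<xi>. [:-\<xi>, 1:]) \<xi>s)"

lemma node_poly_simps [simp]:
  "node_poly [] = 1" "node_poly (\<xi> # \<xi>s) = [:-\<xi>, 1:] * node_poly \<xi>s"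
  by (auto simp: node_poly_def)

lemma newton_cone_add:
  "A \<in> newton_cone \<xi>s \<Longrightarrow> B \<in> newton_cone \<xi>s \<Longrightarrow> A + B \<in> newton_cone \<xi>s"
proof (induction \<xi>s arbitrary: A B)
  case (Cons \<xi> \<xi>s)
  then obtain c A1 d B1 where "c \<ge> 0" "A1 \<in> newton_cone \<xi>s" "A = [:c:] + [:-\<xi>, 1:] * A1"
    "d \<ge> 0" "B1 \<in> newton_cone \<xi>s" "B = [:d:] + [:-\<xi>, 1:] * B1" by auto
  moreover from this have "A + B = [:c + d:] + [:-\<xi>, 1:] * (A1 + B1)"
    by (simp only: distrib_left) simp
  moreover have "A1 + B1 \<in> newton_cone \<xi>s" using Cons.IH calculation by blast
  ultimately show ?case
    by (metis (mono_tags, lifting) newton_cone.simps(2) mem_Collect_eq add_nonneg_nonneg)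
qed auto

lemma newton_cone_degree:
  "B \<in> newton_cone \<xi>s \<Longrightarrow> \<xi>s \<noteq> [] \<Longrightarrow> degree B < length \<xi>s"
proof (induction \<xi>s arbitrary: B)
  case (Cons \<xi> \<xi>s)
  then obtain c B1 where B: "B1 \<in> newton_cone \<xi>s" "B = [:c:] + [:-\<xi>, 1:] * B1" by auto
  have "degree ([:-\<xi>, 1:] * B1) \<le> length \<xi>s"
  proof (cases "\<xi>s = [] \<or> B1 = 0")
    case False
    then show ?thesis
      using Cons.IH[OF B(1)] by (simp add: degree_mult_eq del: mult_pCons_left)
  qed (use B in auto)
  then have "degree B \<le> length \<xi>s" unfolding B by (intro degree_add_le) auto
  then show ?case by simp
qed auto

lemma newton_cone_nonneg:
  "B \<in> newton_cone \<xi>s \<Longrightarrow> (\<And>\<xi>. \<xi> \<in> set \<xi>s \<Longrightarrow> \<xi> \<le> t) \<Longrightarrow> poly B t \<ge> 0"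
proof (induction \<xi>s arbitrary: B)
  case (Cons \<xi> \<xi>s)
  then obtain c B1 where B: "c \<ge> 0" "B1 \<in> newton_cone \<xi>s" "B = [:c:] + [:-\<xi>, 1:] * B1" by auto
  have "poly B1 t \<ge> 0" using Cons B by simp
  moreover have "poly B t = c + (t - \<xi>) * poly B1 t" unfolding B(3) by (simp add: algebra_simps)
  ultimately show ?case using B(1) Cons.prems(2)[of \<xi>] by simp
qed auto

lemma zero_in_newton_cone: "0 \<in> newton_cone \<xi>s"
proof (induction \<xi>s)
  case (Cons \<xi> \<xi>s)
  then have "[:0:] + [:-\<xi>, 1:] * 0 \<in> newton_cone (\<xi> # \<xi>s)"
    unfolding newton_cone.simps by blast
  then show ?case by simp
qed auto

text \<open>\<open>B\<close> interpolates c / (z - t) at the nodes, whose divided differences are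
  positive to the left of the pole. Each step peels off one node and passes the constant c / (z -
  \<xi>) on to the rest.\<close>

lemma newton_cone_const_divide:
  assumes "c \<ge> 0" "\<And>\<xi>. \<xi> \<in> set \<xi>s \<Longrightarrow> \<xi> < z"
  shows "\<exists>B \<in> newton_cone \<xi>s. \<exists>\<beta>\<ge>0. [:c:] = [:z, -1:] * B + smult \<beta> (node_poly \<xi>s)"
  using assms
proof (induction \<xi>s arbitrary: c)
  case Nil
  then show ?case by auto
next
  case (Cons \<xi> \<xi>s)
  have pos: "z - \<xi> > 0" using Cons.prems by auto
  define d where "d = c / (z - \<xi>)"
  have "d \<ge> 0" using pos Cons.prems(1) by (simp add: d_def)
  then obtain B1 \<beta> where B: "B1 \<in> newton_cone \<xi>s" "\<beta> \<ge> 0"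
    "[:d:] = [:z, -1:] * B1 + smult \<beta> (node_poly \<xi>s)"
    using Cons.IH[of d] Cons.prems by auto
  have *: "[:d:] * Z + q * (Z * B1 + smult \<beta> N) = Z * ([:d:] + q * B1) + smult \<beta> (q * N)" for q Z N
    by (simp add: algebra_simps)
  \<comment> \<open>This is c = d (z - t) + d (t - \<xi>); the second \<open>[:d:]\<close> is then
    expanded over the remaining nodes.\<close>
  have "[:c:] = [:d:] * [:z, -1:] + [:-\<xi>, 1:] * [:d:]"
  proof -
    have "c = d * (z - \<xi>)" using pos by (simp add: d_def)
    then show ?thesis by (simp add: algebra_simps)
  qed
  also have "\<dots> = [:d:] * [:z, -1:] + [:-\<xi>, 1:] * ([:z, -1:] * B1 + smult \<beta> (node_poly \<xi>s))"
    by (simp only: B(3))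
  also have "\<dots> = [:z, -1:] * ([:d:] + [:-\<xi>, 1:] * B1) + smult \<beta> (node_poly (\<xi> # \<xi>s))"
    using *[of "[:z, -1:]" "[:-\<xi>, 1:]"] by (simp only: node_poly_simps)
  finally show ?case
    using B(1,2) \<open>d \<ge> 0\<close> by (metis (mono_tags, lifting) newton_cone.simps(2) mem_Collect_eq)
qed

text \<open>Dividing by z - t keeps the Newton coefficients nonnegative: in Horner form the tail is
  divided by the induction hypothesis and the constant term by the preceding lemma.\<close>

lemma newton_cone_divide:
  assumes "A \<in> newton_cone \<xi>s" "\<And>\<xi>. \<xi> \<in> set \<xi>s \<Longrightarrow> \<xi> < z"
  shows "\<exists>B \<in> newton_cone \<xi>s. \<exists>\<beta>\<ge>0. A = [:z, -1:] * B + smult \<beta> (node_poly \<xi>s)"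
  using assms
proof (induction \<xi>s arbitrary: A)
  case Nil
  then show ?case by (auto intro: exI[of _ 0])
next
  case (Cons \<xi> \<xi>s)
  then obtain c A1 where A: "c \<ge> 0" "A1 \<in> newton_cone \<xi>s" "A = [:c:] + [:-\<xi>, 1:] * A1" by auto
  obtain B1 \<beta> where B: "B1 \<in> newton_cone \<xi>s" "\<beta> \<ge> 0"
    "A1 = [:z, -1:] * B1 + smult \<beta> (node_poly \<xi>s)"
    using Cons.IH[OF A(2)] Cons.prems by auto
  obtain C \<gamma> where C: "C \<in> newton_cone (\<xi> # \<xi>s)" "\<gamma> \<ge> 0"
    "[:c:] = [:z, -1:] * C + smult \<gamma> (node_poly (\<xi> # \<xi>s))"
    using newton_cone_const_divide[OF A(1), of "\<xi> # \<xi>s" z] Cons.prems by auto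
  have "[:0:] + [:-\<xi>, 1:] * B1 \<in> newton_cone (\<xi> # \<xi>s)"
    using B(1) unfolding newton_cone.simps by blast
  then have 1: "C + ([:0:] + [:-\<xi>, 1:] * B1) \<in> newton_cone (\<xi> # \<xi>s)"
    using C(1) newton_cone_add by blast
  have *: "(Z * C + smult \<gamma> (q * N)) + q * (Z * B1 + smult \<beta> N) = Z * (C + q * B1) + smult (\<gamma> + \<beta>) (q * N)" for Z q N
    by (simp add: algebra_simps smult_add_left)
  have "A = ([:z, -1:] * C + smult \<gamma> (node_poly (\<xi> # \<xi>s)))
      + [:-\<xi>, 1:] * ([:z, -1:] * B1 + smult \<beta> (node_poly \<xi>s))"
    unfolding A(3) by (simp only: B(3) C(3))
  also have "\<dots> = [:z, -1:] * (C + ([:0:] + [:-\<xi>, 1:] * B1)) + smult (\<gamma> + \<beta>) (node_poly (\<xi> # \<xi>s))"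
    using *[of "[:z, -1:]" "[:-\<xi>, 1:]" "node_poly \<xi>s"] by (simp only: node_poly_simps pCons_0_0 add_0)
  finally show ?case using 1 B(2) C(2) by (metis add_nonneg_nonneg)
qed

definition pole_poly :: "real list \<Rightarrow> real poly" where
  "pole_poly zs = prod_list (map (\<lambda>z. [:z, -1:]) zs)"

lemma pole_poly_simps [simp]:
  "pole_poly [] = 1" "pole_poly (z # zs) = [:z, -1:] * pole_poly zs"
  by (auto simp: pole_poly_def)

lemma degree_pole_poly: "degree (pole_poly zs) = length zs \<and> pole_poly zs \<noteq> 0"
  by (induction zs) (auto simp: degree_mult_eq simp del: mult_pCons_left)

lemma pole_poly_nonneg: "(\<And>z. z \<in> set zs \<Longrightarrow> t \<le> z) \<Longrightarrow> poly (pole_poly zs) t \<ge> 0"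
  by (induction zs) (auto simp: simp del: mult_pCons_left)

text \<open>\<open>B\<close> is the Hermite interpolant of \<open>1 / pole_poly zs\<close> at the nodes \<open>\<xi>s\<close>. That function is
  absolutely monotone to the left of its poles, so the Newton coefficients of \<open>B\<close> are nonnegative.\<close>

lemma inverse_pole_poly_interpolation:
  assumes "\<xi>s \<noteq> []" "\<And>\<xi>. \<xi> \<in> set \<xi>s \<Longrightarrow> \<xi> \<le> x" "\<And>z. z \<in> set zs \<Longrightarrow> x < z"
  shows "\<exists>B \<in> newton_cone \<xi>s. \<exists>A. 1 - B * pole_poly zs = node_poly \<xi>s * A \<and> (\<forall>t\<le>x. poly A t \<ge> 0)"
  using assms(3)
proof (induction zs)
  case Nil
  obtain \<xi> \<xi>s' where "\<xi>s = \<xi> # \<xi>s'" using assms(1) by (cases \<xi>s) auto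
  moreover have "[:1:] + [:-\<xi>, 1:] * 0 \<in> newton_cone (\<xi> # \<xi>s')"
    using zero_in_newton_cone zero_le_one unfolding newton_cone.simps by blast
  ultimately have "1 \<in> newton_cone \<xi>s" by (simp add: one_pCons)
  then show ?case by (intro bexI[of _ 1] exI[of _ 0]) auto
next
  case (Cons z zs)
  obtain B A where BA: "B \<in> newton_cone \<xi>s" "1 - B * pole_poly zs = node_poly \<xi>s * A"
    "\<And>t. t \<le> x \<Longrightarrow> poly A t \<ge> 0"
    using Cons by auto
  \<comment> \<open>A new pole divides \<open>B\<close> by z - t. The remainder is a nonnegative
    multiple of the node polynomial, so it only adds a nonnegative term to the cofactor
    \<open>A\<close>.\<close>
  obtain B' \<beta> where B': "B' \<in> newton_cone \<xi>s" "\<beta> \<ge> 0" "B = [:z, -1:] * B' + smult \<beta> (node_poly \<xi>s)"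
    using newton_cone_divide[OF BA(1), of z] assms(2) Cons.prems by fastforce
  have "1 - B' * pole_poly (z # zs) = 1 - (B - smult \<beta> (node_poly \<xi>s)) * pole_poly zs"
    unfolding B'(3) pole_poly_simps add_diff_cancel_right' by (simp only: ac_simps)
  also have "\<dots> = (1 - B * pole_poly zs) + node_poly \<xi>s * smult \<beta> (pole_poly zs)"
    by (simp add: algebra_simps)
  also have "\<dots> = node_poly \<xi>s * (A + smult \<beta> (pole_poly zs))"
    unfolding BA(2) by (simp add: algebra_simps)
  finally have "1 - B' * pole_poly (z # zs) = node_poly \<xi>s * (A + smult \<beta> (pole_poly zs))" .
  moreover have "poly (A + smult \<beta> (pole_poly zs)) t \<ge> 0" if "t \<le> x" for t
    using BA(3)[OF that] B'(2) pole_poly_nonneg[of zs t] Cons.prems that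
    by (force intro!: add_nonneg_nonneg mult_nonneg_nonneg)
  ultimately show ?case using B'(1) by blast
qed

text \<open>An interior zero of a polynomial that is nonnegative on \<open>[-1,1]\<close> is at least double.\<close>

definition node_mult :: "real \<Rightarrow> nat" where
  "node_mult z = (if \<bar>z\<bar> = 1 then 1 else 2)"

definition node_list :: "real set \<Rightarrow> real list" where
  "node_list Z = concat (map (\<lambda>z. replicate (node_mult z) z) (sorted_list_of_set Z))"

lemma set_node_list: "finite Z \<Longrightarrow> set (node_list Z) = Z"
  by (auto simp: node_list_def node_mult_def)

lemma length_node_list: "finite Z \<Longrightarrow> length (node_list Z) = (\<Sum>z\<in>Z. node_mult z)"
  by (simp add: node_list_def length_concat comp_def sum.distinct_set_conv_list[symmetric])

lemma prod_node_list: "finite Z \<Longrightarrow> prod_list (map f (node_list Z)) = (\<Prod>z\<in>Z. (f z :: real) ^ node_mult z)"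
proof -
  assume Z: "finite Z"
  have "prod_list (map f (concat (map (\<lambda>z. replicate (node_mult z) z) xs)))
     = prod_list (map (\<lambda>z. f z ^ node_mult z) xs)" for xs
    by (induction xs) (auto simp: prod_list_replicate)
  then show ?thesis
    using Z by (simp add: node_list_def prod.distinct_set_conv_list[symmetric])
qed

lemma poly_node_poly: "poly (node_poly \<xi>s) t = prod_list (map (\<lambda>\<xi>. t - \<xi>) \<xi>s)"
  by (induction \<xi>s) (auto simp: algebra_simps)

lemma poly_pole_poly: "poly (pole_poly zs) t = prod_list (map (\<lambda>z. z - t) zs)"
  by (induction zs) (auto simp: algebra_simps)

text \<open>Zeros to the right of the jump are built in as factors; the other factor interpolates
  their reciprocal at \<open>x\<close> and at the nodes to its left. The error 1 - P is then the
  node polynomial times a cofactor nonnegative up to \<open>x\<close>, and even multiplicities leave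
  the sign to t - x.\<close>

lemma step_majorant:
  assumes Z: "finite Z" "Z \<subseteq> {-1..1}" and x: "x \<in> {-1<..<1}" "x \<notin> Z"
    and N: "(\<Sum>z\<in>Z. node_mult z) \<le> N"
  shows "\<exists>P. degree P \<le> N \<and> (\<forall>t\<in>{-1..x}. poly P t \<ge> 1) \<and> (\<forall>t\<in>{x..1}. poly P t \<ge> 0) \<and> poly P x = 1
     \<and> (\<forall>z\<in>Z. poly P z = (if z < x then 1 else 0))"
proof -
  define L U where "L = {z\<in>Z. z < x}" and "U = {z\<in>Z. x < z}"
  have fin: "finite L" "finite U" using Z by (auto simp: L_def U_def)
  have ZLU: "Z = L \<union> U" "L \<inter> U = {}" using x(2) by (auto simp: L_def U_def not_less) (metis less_eq_real_def)
  \<comment> \<open>The jump is a simple node: its factor alone changes sign, and it costs no degree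
    because \<open>B\<close> has degree below the number of nodes.\<close>
  define \<xi>s where "\<xi>s = x # node_list L"
  define zs where "zs = node_list U"
  have set: "set \<xi>s = insert x L" "set zs = U" using fin by (auto simp: \<xi>s_def zs_def set_node_list)
  obtain B A where BA: "B \<in> newton_cone \<xi>s" "1 - B * pole_poly zs = node_poly \<xi>s * A"
    "\<And>t. t \<le> x \<Longrightarrow> poly A t \<ge> 0"
  proof -
    have "\<xi>s \<noteq> []" by (simp add: \<xi>s_def)
    moreover have "\<xi> \<le> x" if "\<xi> \<in> set \<xi>s" for \<xi> using that set by (auto simp: L_def)
    moreover have "x < z" if "z \<in> set zs" for z using that set by (auto simp: U_def)
    ultimately show ?thesis using inverse_pole_poly_interpolation[of \<xi>s x zs] that by blast
  qed
  define P where "P = B * pole_poly zs"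
  have P1: "poly P t = 1 - poly (node_poly \<xi>s) t * poly A t" for t
    using arg_cong[OF BA(2), of "\<lambda>p. poly p t"] by (simp add: P_def algebra_simps)
  have "length (node_list L) + length zs \<le> N"
    using N fin sum.union_disjoint[of L U node_mult] ZLU by (simp add: zs_def length_node_list)
  moreover have "degree B \<le> length (node_list L)"
    using newton_cone_degree[OF BA(1)] by (simp add: \<xi>s_def)
  ultimately have "degree P \<le> N"
    using degree_mult_le[of B "pole_poly zs"] degree_pole_poly[of zs] by (simp add: P_def)
  moreover have "poly P t \<ge> 1" if "t \<in> {-1..x}" for t
  proof -
    have "poly (node_poly (node_list L)) t \<ge> 0"
      unfolding poly_node_poly prod_node_list[OF fin(1)]
    proof (rule prod_nonneg)
      fix z assume "z \<in> L"
      \<comment> \<open>The only left node of odd multiplicity can be -1, where t - z is nonnegative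
        on the whole interval.\<close>
      then have "\<bar>z\<bar> = 1 \<Longrightarrow> z = -1" using x Z by (auto simp: L_def)
      then show "0 \<le> (t - z) ^ node_mult z" using that by (auto simp: node_mult_def)
    qed
    then have "poly (node_poly \<xi>s) t \<le> 0"
      using that by (simp add: \<xi>s_def mult_nonpos_nonneg algebra_simps mult_right_mono)
    then show ?thesis
      using BA(3)[of t] that P1 by (simp add: mult_nonpos_nonneg)
  qed
  moreover have "poly P t \<ge> 0" if "t \<in> {x..1}" for t
  proof -
    have "poly B t \<ge> 0" by (rule newton_cone_nonneg[OF BA(1)]) (use that set in \<open>auto simp: L_def\<close>)
    moreover have "poly (pole_poly zs) t \<ge> 0"
      unfolding zs_def poly_pole_poly prod_node_list[OF fin(2)]
    proof (rule prod_nonneg)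
      fix z assume "z \<in> U"
      then have "\<bar>z\<bar> = 1 \<Longrightarrow> z = 1" using x Z by (auto simp: U_def)
      then show "0 \<le> (z - t) ^ node_mult z" using that by (auto simp: node_mult_def)
    qed
    ultimately show ?thesis by (simp add: P_def)
  qed
  moreover have "poly P z = 1" if "z \<in> set \<xi>s" for z
  proof -
    have "poly (node_poly \<xi>s) z = 0"
      unfolding poly_node_poly using that by (auto simp: prod_list_zero_iff)
    then show ?thesis using P1 by simp
  qed
  moreover have "poly P z = 0" if "z \<in> set zs" for z
  proof -
    have "poly (pole_poly zs) z = 0"
      unfolding poly_pole_poly using that by (auto simp: prod_list_zero_iff)
    then show ?thesis by (simp add: P_def)
  qed
  ultimately have P: "degree P \<le> N" "\<forall>t\<in>{-1..x}. poly P t \<ge> 1" "\<forall>t\<in>{x..1}. poly P t \<ge> 0"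
    "\<And>z. z \<in> insert x L \<Longrightarrow> poly P z = 1" "\<And>z. z \<in> U \<Longrightarrow> poly P z = 0"
    using set by auto
  have "poly P z = (if z < x then 1 else 0)" if "z \<in> Z" for z
  proof -
    have "z \<in> U" if "\<not> z < x" using that \<open>z \<in> Z\<close> x(2) by (cases "z = x") (auto simp: U_def)
    moreover have "z \<in> insert x L" if "z < x" using that \<open>z \<in> Z\<close> by (auto simp: L_def)
    ultimately show ?thesis using P(4)[of z] P(5)[of z] by presburger
  qed
  then show ?thesis using P(1-4) by blast
qed

section \<open>Canonical quadratures\<close>

locale lipschitz_weight =
  fixes w :: "real \<Rightarrow> real" and m R :: real
  assumes m_pos: "m > 0" and R_pos: "R > 0"
    and w_ge: "t \<in> {-1..1} \<Longrightarrow> m \<le> w t"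
    and w_lipschitz: "s \<in> {-1..1} \<Longrightarrow> t \<in> {-1..1} \<Longrightarrow> \<bar>w s - w t\<bar> \<le> R * \<bar>s - t\<bar>"
begin

section \<open>The weighted integral as a positive functional\<close>

definition functional :: "real poly \<Rightarrow> real" where
  "functional p = integral {-1..1} (\<lambda>t. poly p t * w t)"

lemma continuous_w: "continuous_on {-1..1} w"
proof (rule lipschitz_on_continuous_on)
  show "R-lipschitz_on {-1..1} w"
    using w_lipschitz R_pos by (auto intro!: lipschitz_onI simp: dist_real_def)
qed

lemma w_integrable: "a \<in> {-1..1} \<Longrightarrow> b \<in> {-1..1} \<Longrightarrow> w integrable_on {a..b}"
  by (intro integrable_continuous_real continuous_on_subset[OF continuous_w]) auto

lemma poly_w_integrable: "a \<in> {-1..1} \<Longrightarrow> b \<in> {-1..1} \<Longrightarrow> (\<lambda>t. poly p t * w t) integrable_on {a..b}"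
  by (intro integrable_continuous_real continuous_intros continuous_on_subset[OF continuous_w]) auto

lemma functional_add: "functional (p + q) = functional p + functional q"
  using poly_w_integrable[of "-1" 1]
  by (simp add: functional_def distrib_right integral_add)

lemma functional_smult: "functional (smult c p) = c * functional p"
  by (simp add: functional_def mult.assoc)

lemma functional_diff: "functional (p - q) = functional p - functional q"
  using functional_add[of p "smult (-1) q"] functional_smult[of "-1" q] by simp

lemma functional_0 [simp]: "functional 0 = 0"
  by (simp add: functional_def)

lemma functional_sum: "functional (\<Sum>k\<in>A. f k) = (\<Sum>k\<in>A. functional (f k))"
  by (induction A rule: infinite_finite_induct) (auto simp: functional_add)

lemma functional_ge_integral:
  assumes "\<And>t. t \<in> {-1..1} \<Longrightarrow> poly p t \<ge> 0"
  shows "m * integral {-1..1} (poly p) \<le> functional p"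
proof -
  have "integral {-1..1} (\<lambda>t. m * poly p t) \<le> functional p"
    unfolding functional_def
  proof (rule integral_le)
    show "(\<lambda>t. m * poly p t) integrable_on {-1..1}"
      by (intro integrable_continuous_real continuous_intros)
    fix t :: real assume "t \<in> {-1..1}"
    then show "m * poly p t \<le> poly p t * w t"
      using mult_right_mono[OF w_ge[of t] assms[of t]] by (simp add: mult.commute)
  qed (use poly_w_integrable in auto)
  then show ?thesis by simp
qed

lemma functional_nonneg:
  assumes "\<And>t. t \<in> {-1..1} \<Longrightarrow> poly p t \<ge> 0"
  shows "functional p \<ge> 0"
proof -
  have "integral {-1..1} (poly p) \<ge> 0"
    using assms by (intro integral_nonneg integrable_continuous_real continuous_intros)
  then show ?thesis
    using functional_ge_integral[OF assms] m_pos by (meson mult_nonneg_nonneg order.trans less_imp_le)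
qed

lemma functional_1_pos: "functional 1 > 0"
proof -
  have "poly 1 = (\<lambda>_. 1 :: real)" by auto
  then show ?thesis using functional_ge_integral[of 1] m_pos by simp
qed

text \<open>Compactness in coefficient space: competitors no worse than the constant 1 have
  second-kind coefficients bounded by \<open>M\<close>, and the minimum of the continuous objective
  over this box is global.\<close>

lemma minimal_nonneg_poly_exists:
  assumes "x \<in> {-1..1}" "N > 0"
  shows "\<exists>K. degree K < N \<and> (\<forall>t\<in>{-1..1}. poly K t \<ge> 0) \<and> poly K x \<ge> 1 \<and>
    (\<forall>q. degree q < N \<and> (\<forall>t\<in>{-1..1}. poly q t \<ge> 0) \<and> poly q x \<ge> 1 \<longrightarrow> functional K \<le> functional q)"
proof -
  define M where "M = functional 1 / m"
  define Q where "Q b = (\<Sum>k<N. smult (b k) (cheb_U k))" for b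
  \<comment> \<open>Infinite coefficient sequences in a product of intervals, compact by Tychonoff.
    Entries from index \<open>N\<close> on do not enter \<open>Q\<close>, and \<open>feas\<close>
    sets them to zero.\<close>
  define S where "S = PiE UNIV (\<lambda>_::nat. {-M..M}) \<inter> ((\<Inter>t\<in>{-1..1}. {b. 0 \<le> poly (Q b) t}) \<inter> {b. 1 \<le> poly (Q b) x})"
  have polyQ: "poly (Q b) t = (\<Sum>k<N. b k * poly (cheb_U k) t)" for b t
    by (simp add: Q_def poly_sum)
  have fQ: "functional (Q b) = (\<Sum>k<N. b k * functional (cheb_U k))" for b
    by (simp add: Q_def functional_sum functional_smult)
  have degQ: "degree (Q b) < N" for b
  proof -
    have "degree (Q b) \<le> N - 1" unfolding Q_def
      by (intro degree_sum_le order.trans[OF degree_smult_le] order.trans[OF cheb_U_degree]) auto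
    then show ?thesis using assms by simp
  qed
  have "compact (PiE UNIV (\<lambda>_::nat. {-M..M}))"
    using compactin_PiE[of "\<lambda>_::nat. euclidean :: real topology" UNIV "\<lambda>_. {-M..M}"]
    by (simp add: euclidean_product_topology)
  moreover have "closed ((\<Inter>t\<in>{-1..1}. {b. 0 \<le> poly (Q b) t}) \<inter> {b. 1 \<le> poly (Q b) x})"
    unfolding polyQ by (intro closed_Int closed_INT ballI closed_Collect_le continuous_intros) auto
  ultimately have "compact S" unfolding S_def by (rule compact_Int_closed)
  have feas: "\<exists>b\<in>S. Q b = q"
    if q: "degree q < N" "\<And>t. t \<in> {-1..1} \<Longrightarrow> poly q t \<ge> 0" "poly q x \<ge> 1" "functional q \<le> functional 1" for q
  proof -
    obtain b where b: "q = Q b" using cheb_U_span[OF q(1)] by (auto simp: Q_def)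
    have Qcut: "Q (\<lambda>k. if k < N then b k else 0) = Q b"
      unfolding Q_def by (intro sum.cong) auto
    have "integral {-1..1} (poly q) \<le> M"
      using functional_ge_integral[OF q(2)] q(4) m_pos by (simp add: M_def field_simps)
    then have "\<bar>b k\<bar> \<le> M" if "k < N" for k
      using cheb_U_coefficient_bound[where N = N and b = b and j = k] that q(2)
      unfolding b Q_def by fastforce
    moreover have "M \<ge> 0" using functional_1_pos m_pos by (simp add: M_def)
    ultimately have "(\<lambda>k. if k < N then b k else 0) \<in> PiE UNIV (\<lambda>_::nat. {-M..M})"
      by (auto simp: abs_le_iff minus_le_iff)
    then show ?thesis
      using q(2,3) b Qcut by (intro bexI[of _ "\<lambda>k. if k < N then b k else 0"]) (auto simp: S_def)
  qed
  have "S \<noteq> {}" using feas[of 1] assms by auto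
  moreover have "continuous_on S (\<lambda>b. functional (Q b))"
    unfolding fQ by (intro continuous_intros continuous_on_subset[OF continuous_on_product_coordinates]) auto
  ultimately obtain b where b: "b \<in> S" "\<And>c. c \<in> S \<Longrightarrow> functional (Q b) \<le> functional (Q c)"
    using continuous_attains_inf[OF \<open>compact S\<close>] by metis
  have "functional (Q b) \<le> functional 1"
    using feas[of 1] assms b(2) by force
  then have "functional (Q b) \<le> functional q"
    if "degree q < N" "\<forall>t\<in>{-1..1}. poly q t \<ge> 0" "poly q x \<ge> 1" for q
    using feas[of q] b(2) that by (cases "functional q \<le> functional 1") force+
  then show ?thesis
    using b(1) degQ[of b] by (intro exI[of _ "Q b"]) (auto simp: S_def)
qed

text \<open>First-order optimality. After adding \<delta> > 0 to \<open>q\<close>, the minimiser is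
  bounded away from zero wherever the sum is not positive, so a small multiple of the sum can be
  added to \<open>K\<close>; minimality gives the sign, and \<delta> tends to zero.\<close>

lemma functional_nonneg_on_contact_set:
  assumes x: "x \<in> {-1..1}" and N: "N > 0"
    and K: "degree K < N" "\<And>t. t \<in> {-1..1} \<Longrightarrow> poly K t \<ge> 0" "poly K x \<ge> 1"
    and min: "\<And>q. degree q < N \<Longrightarrow> (\<And>t. t \<in> {-1..1} \<Longrightarrow> poly q t \<ge> 0) \<Longrightarrow> poly q x \<ge> 1 \<Longrightarrow>
       functional K \<le> functional q"
    and q: "degree q < N" "poly q x \<ge> 0" "\<And>t. t \<in> {-1..1} \<Longrightarrow> poly K t = 0 \<Longrightarrow> poly q t \<ge> 0"
  shows "functional q \<ge> 0"
proof -
  have *: "functional q + \<delta> * functional 1 \<ge> 0" if "\<delta> > 0" for \<delta>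
  proof -
    define p where "p = q + [:\<delta>:]"
    have p: "degree p < N" "functional p = functional q + \<delta> * functional 1"
      using q(1) N functional_smult[of \<delta> 1] by (auto simp: p_def functional_add intro!: degree_add_less)
    define S where "S = {-1..1} \<inter> {t. poly p t \<le> 0}"
    have "compact S"
      unfolding S_def by (intro compact_Int_closed closed_Collect_le continuous_intros) auto
    have "\<exists>\<epsilon>>0. \<forall>t\<in>{-1..1}. poly K t + \<epsilon> * poly p t \<ge> 0"
    proof (cases "S = {}")
      case True
      then show ?thesis using K(2) by (intro exI[of _ 1]) (force simp: S_def)
    next
      case False
      obtain a where a: "a \<in> S" "\<And>t. t \<in> S \<Longrightarrow> poly K a \<le> poly K t"
        using continuous_attains_inf[OF \<open>compact S\<close> False, of "poly K"] continuous_on_poly[OF continuous_on_id] by metis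
      have "poly K a > 0"
        using a(1) K(2)[of a] q(3)[of a] \<open>\<delta> > 0\<close> by (force simp: S_def p_def)
      obtain c where c: "c \<in> S" "\<And>t. t \<in> S \<Longrightarrow> poly p c \<le> poly p t"
        using continuous_attains_inf[OF \<open>compact S\<close> False, of "poly p"] continuous_on_poly[OF continuous_on_id] by metis
      \<comment> \<open>The minimum of \<open>K\<close> on the bad set over the largest deficit of
        \<open>p\<close> there; the extra 1 keeps the denominator positive.\<close>
      define \<epsilon> where "\<epsilon> = poly K a / (1 - poly p c)"
      have c0: "poly p c \<le> 0" using c(1) by (simp add: S_def)
      then have "\<epsilon> > 0" using \<open>poly K a > 0\<close> by (simp add: \<epsilon>_def)
      moreover have "poly K t + \<epsilon> * poly p t \<ge> 0" if t: "t \<in> {-1..1}" for t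
      proof (cases "t \<in> S")
        case True
        have "\<epsilon> * (- poly p t) \<le> \<epsilon> * (1 - poly p c)"
          using c(2)[OF True] \<open>\<epsilon> > 0\<close> by (intro mult_left_mono) auto
        also have "\<dots> = poly K a" using c0 by (simp add: \<epsilon>_def)
        finally show ?thesis using a(2)[OF True] by simp
      next
        case False
        then have "poly p t > 0" using t by (simp add: S_def)
        then show ?thesis using K(2)[OF t] \<open>\<epsilon> > 0\<close> by simp
      qed
      ultimately show ?thesis by blast
    qed
    then obtain \<epsilon> where e: "\<epsilon> > 0" "\<And>t. t \<in> {-1..1} \<Longrightarrow> poly (K + smult \<epsilon> p) t \<ge> 0" by auto
    have "functional K \<le> functional (K + smult \<epsilon> p)"
    proof (rule min)
      show "degree (K + smult \<epsilon> p) < N"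
        using K(1) p(1) by (intro degree_add_less) (auto simp: le_less_trans[OF degree_smult_le])
      have "\<epsilon> * poly p x \<ge> 0" using e(1) q(2) \<open>\<delta> > 0\<close> by (simp add: p_def)
      then show "1 \<le> poly (K + smult \<epsilon> p) x" using K(3) by simp
    qed (rule e(2))
    then have "0 \<le> \<epsilon> * functional p" by (simp add: functional_add functional_smult)
    then show ?thesis using e(1) p(2) by (simp add: zero_le_mult_iff)
  qed
  show ?thesis
  proof (rule field_le_epsilon)
    fix e :: real assume "e > 0"
    then show "0 \<le> functional q + e"
      using *[of "e / functional 1"] functional_1_pos by simp
  qed
qed

end

text \<open>An interior zero is a local minimum, so the derivative vanishes there as well and the
  order is at least two; the orders of the roots add up to at most the degree.\<close>

lemma node_mult_sum_le_degree:
  assumes "K \<noteq> 0" and nn: "\<And>t. t \<in> {-1..1} \<Longrightarrow> poly K t \<ge> 0"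
  shows "(\<Sum>z\<in>{z\<in>{-1..1}. poly K z = 0}. node_mult z) \<le> degree K"
proof -
  have fin: "finite {z. poly K z = 0}" using assms by (simp add: poly_roots_finite)
  have "node_mult z \<le> order z K" if z: "z \<in> {-1..1}" "poly K z = 0" for z
  proof (cases "\<bar>z\<bar> = 1")
    case True
    then show ?thesis using z assms(1) order_root[of K z] by (auto simp: node_mult_def)
  next
    case False
    then have "poly (pderiv K) z = 0"
      using z nn by (intro DERIV_local_min[OF poly_DERIV, of "min (1 - z) (1 + z)" z K]) (auto simp: abs_if split: if_splits)
    moreover have "pderiv K \<noteq> 0"
    proof
      assume "pderiv K = 0"
      then have "degree K = 0" by (simp add: pderiv_eq_0_iff)
      then show False using z(2) assms(1) by (auto elim: degree_eq_zeroE)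
    qed
    ultimately have "order z (pderiv K) \<noteq> 0" using order_root by blast
    then show ?thesis
      using order_pderiv[OF assms(1) z(2)] by (simp add: node_mult_def)
  qed
  then have "(\<Sum>z\<in>{z\<in>{-1..1}. poly K z = 0}. node_mult z) \<le> (\<Sum>z\<in>{z\<in>{-1..1}. poly K z = 0}. order z K)"
    by (intro sum_mono) auto
  also have "\<dots> \<le> (\<Sum>z\<in>{z. poly K z = 0}. order z K)"
    by (intro sum_mono2 fin) auto
  also have "\<dots> = size (proots K)"
    using assms(1) by (simp add: size_multiset_overloaded_eq)
  finally show ?thesis using size_proots_le[of K] by simp
qed

lemma lagrange_basis_exists:
  fixes Z :: "real set"
  assumes "finite Z" "z \<in> Z"
  shows "\<exists>l. degree l < card Z \<and> (\<forall>y\<in>Z. poly l y = (if y = z then 1 else 0))"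
proof -
  define l where "l = (\<Prod>y\<in>Z - {z}. smult (1 / (z - y)) [:-y, 1:])"
  have "degree l \<le> (\<Sum>y\<in>Z - {z}. 1)"
    unfolding l_def by (rule order.trans[OF degree_prod_sum_le]) (use assms in \<open>auto intro!: sum_mono\<close>)
  then have "degree l < card Z"
    using assms card_gt_0_iff[of Z] by (auto simp: card_Diff_singleton)
  moreover have "poly l y = (if y = z then 1 else 0)" if "y \<in> Z" for y
  proof (cases "y = z")
    case True
    have "poly (smult (1 / (z - u)) [:-u, 1:]) z = 1" if "u \<in> Z - {z}" for u
    proof -
      have "poly [:-u, 1:] z = z - u" by simp
      then show ?thesis using that by (simp only: poly_smult) simp
    qed
    then show ?thesis using True by (simp add: l_def poly_prod del: poly_smult)
  next
    case False
    then show ?thesis using assms that by (auto simp: l_def poly_prod intro!: bexI[of _ y])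
  qed
  ultimately show ?thesis by blast
qed

context lipschitz_weight
begin

text \<open>Optimality of \<open>K\<close> makes the functional nonnegative on every polynomial that is nonnegative on the
  contact set of \<open>K\<close>; by Lagrange interpolation it is then a quadrature supported there.\<close>

lemma canonical_quadrature:
  assumes x: "x \<in> {-1<..<1}" and N: "N > 0"
  shows "\<exists>Z \<alpha>. finite Z \<and> Z \<subseteq> {-1..1} \<and> x \<notin> Z \<and> (\<Sum>z\<in>Z. node_mult z) < N \<and>
    (\<forall>z\<in>insert x Z. \<alpha> z \<ge> 0) \<and>
    (\<forall>q. degree q < N \<longrightarrow> functional q = (\<Sum>z\<in>insert x Z. \<alpha> z * poly q z))"
proof -
  have x': "x \<in> {-1..1}" using x by auto
  obtain K where K: "degree K < N" "\<And>t. t \<in> {-1..1} \<Longrightarrow> poly K t \<ge> 0" "poly K x \<ge> 1"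
    and min: "\<And>q. degree q < N \<Longrightarrow> (\<And>t. t \<in> {-1..1} \<Longrightarrow> poly q t \<ge> 0) \<Longrightarrow> poly q x \<ge> 1 \<Longrightarrow>
       functional K \<le> functional q"
    using minimal_nonneg_poly_exists[OF x' N] by blast
  define Z where "Z = {z\<in>{-1..1}. poly K z = 0}"
  have "K \<noteq> 0" using K(3) by auto
  then have fin: "finite Z" unfolding Z_def using poly_roots_finite[of K] by (auto intro: finite_subset)
  have xZ: "x \<notin> Z" using K(3) by (simp add: Z_def)
  have mult: "(\<Sum>z\<in>Z. node_mult z) < N"
    using node_mult_sum_le_degree[OF \<open>K \<noteq> 0\<close> K(2)] K(1) by (simp add: Z_def)
  \<comment> \<open>The multiplicity sum lies strictly below \<open>N\<close>, which leaves room for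
    \<open>x\<close>: Lagrange interpolation on \<open>insert x Z\<close> stays within the
    admissible degrees.\<close>
  have "card Z \<le> (\<Sum>z\<in>Z. node_mult z)"
    using sum_mono[of Z "\<lambda>_. 1" node_mult] by (auto simp: node_mult_def)
  then have card: "card (insert x Z) \<le> N" using mult fin xZ by simp
  have pos: "functional q \<ge> 0" if "degree q < N" "\<And>z. z \<in> insert x Z \<Longrightarrow> poly q z \<ge> 0" for q
    by (rule functional_nonneg_on_contact_set[OF x' N K min]) (use that in \<open>auto simp: Z_def\<close>)
  have "\<exists>l. \<forall>z\<in>insert x Z. degree (l z) < card (insert x Z) \<and>
      (\<forall>y\<in>insert x Z. poly (l z) y = (if y = z then 1 else 0))"
    using lagrange_basis_exists[of "insert x Z"] fin by (intro bchoice ballI) blast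
  then obtain l where l: "\<And>z. z \<in> insert x Z \<Longrightarrow> degree (l z) < N"
     "\<And>y z. z \<in> insert x Z \<Longrightarrow> y \<in> insert x Z \<Longrightarrow> poly (l z) y = (if y = z then 1 else 0)"
    using card by (metis order.strict_trans2)
  have "functional q = (\<Sum>z\<in>insert x Z. functional (l z) * poly q z)" if q: "degree q < N" for q
  proof -
    define p where "p = q - (\<Sum>z\<in>insert x Z. smult (poly q z) (l z))"
    have "degree (\<Sum>z\<in>insert x Z. smult (poly q z) (l z)) \<le> N - 1"
      using l(1) fin N by (intro degree_sum_le order.trans[OF degree_smult_le]) fastforce+
    then have deg: "degree p < N" unfolding p_def using q N by (intro degree_diff_less) auto
    have p0: "poly p y = 0" if y: "y \<in> insert x Z" for y
    proof -
      have "(\<Sum>z\<in>insert x Z. poly q z * poly (l z) y) = (\<Sum>z\<in>insert x Z. poly q z * (if y = z then 1 else 0))"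
        using l(2) y by (intro sum.cong) auto
      also have "\<dots> = poly q y"
        using y fin sum.delta[of "insert x Z" y "poly q"]
        by (simp only: mult.right_neutral mult_zero_right if_distrib finite_insert if_True eq_commute[of y] cong: if_cong)
      finally show ?thesis by (simp add: p_def poly_sum)
    qed
    \<comment> \<open>The interpolation error vanishes on all of \<open>insert x Z\<close>, so
      positivity applies to it and to its negative.\<close>
    have "functional p \<ge> 0" using pos[OF deg] p0 by simp
    moreover have "functional (smult (-1) p) \<ge> 0"
      by (rule pos) (use deg p0 in \<open>auto simp: le_less_trans[OF degree_smult_le]\<close>)
    ultimately have "functional p = 0" by (simp only: functional_smult)
    then show ?thesis
      by (simp add: p_def functional_diff functional_sum functional_smult mult.commute)
  qed
  moreover have "functional (l z) \<ge> 0" if "z \<in> insert x Z" for z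
    using l that by (intro pos) auto
  moreover have "Z \<subseteq> {-1..1}" by (auto simp: Z_def)
  ultimately show ?thesis
    using fin xZ mult by (intro exI[of _ Z] exI[of _ "\<lambda>z. functional (l z)"] conjI) blast+
qed

end

section \<open>Extremal polynomials for the moment problem\<close>

context lipschitz_weight
begin

section \<open>Moment measures and polynomial majorants\<close>

lemma measure_le_functional:
  assumes \<mu>: "\<mu> \<in> moment_measures w n" and Q: "degree Q \<le> 2 * n - 1"
    and A: "A \<in> sets borel"
    and le: "\<And>t. t \<in> {-1..1} \<Longrightarrow> indicat_real A t \<le> poly Q t"
  shows "measure \<mu> A \<le> functional Q"
proof -
  have sets: "sets \<mu> = sets borel" and null: "emeasure \<mu> (- {-1..1}) = 0"
    and int: "\<And>p. degree p \<le> 2 * n - 1 \<Longrightarrow> integrable \<mu> (poly p) \<and>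
       (\<integral>t. poly p t \<partial>\<mu>) = integral {-1..1} (\<lambda>t. poly p t * w t)"
    using \<mu> by (auto simp: moment_measures_def)
  have space: "space \<mu> = UNIV" using sets_eq_imp_space_eq[OF sets] by simp
  \<comment> \<open>Finiteness of the measure comes from the moment condition for the constant
    polynomial.\<close>
  have "integrable \<mu> (poly 1)" using int[of 1] by simp
  moreover have "poly 1 = (\<lambda>_. 1 :: real)" by auto
  ultimately have "integrable \<mu> (\<lambda>_. 1 :: real)" by simp
  then have "emeasure \<mu> (space \<mu>) < \<infinity>"
    by (simp add: integrable_iff_bounded space)
  then interpret finite_measure \<mu> by (intro finite_measureI) auto
  have AE: "AE t in \<mu>. t \<in> {-1..1}"
    using null by (intro AE_I[of _ _ "- {-1..1}"]) (auto simp: sets)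
  have "measure \<mu> A = (\<integral>t. indicat_real A t \<partial>\<mu>)"
    using A by (simp add: space)
  also have "\<dots> \<le> (\<integral>t. poly Q t \<partial>\<mu>)"
  proof (rule integral_mono_AE)
    show "integrable \<mu> (indicat_real A)"
      using A by (intro integrable_real_indicator) (auto simp: sets emeasure_finite less_top[symmetric])
    show "AE t in \<mu>. indicat_real A t \<le> poly Q t"
      using AE by eventually_elim (rule le)
  qed (use int Q in blast)
  also have "\<dots> = functional Q" using int[OF Q] by (simp add: functional_def)
  finally show ?thesis .
qed

lemma quadrature_moment_measure:
  assumes fin: "finite Z" and Z: "Z \<subseteq> {-1..1}" and nonneg: "\<And>z. z \<in> Z \<Longrightarrow> \<alpha> z \<ge> 0"
    and exact: "\<And>q. degree q \<le> 2 * n - 1 \<Longrightarrow> functional q = (\<Sum>z\<in>Z. \<alpha> z * poly q z)"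
  shows "\<exists>\<mu>\<in>moment_measures w n. \<forall>A\<in>sets borel. measure \<mu> A = (\<Sum>z\<in>Z \<inter> A. \<alpha> z)"
proof -
  define M where "M = point_measure Z (\<lambda>z. ennreal (\<alpha> z))"
  define \<mu> where "\<mu> = distr M borel (\<lambda>z. z)"
  have meas: "(\<lambda>z. z) \<in> measurable M borel" by (simp add: M_def)
  have em: "emeasure \<mu> A = (\<Sum>z\<in>Z \<inter> A. ennreal (\<alpha> z))" if "A \<in> sets borel" for A
    unfolding \<mu>_def emeasure_distr[OF meas that]
    using fin by (simp add: M_def space_point_measure emeasure_point_measure_finite Int_commute)
  have "\<mu> \<in> moment_measures w n"
    unfolding moment_measures_def
  proof (intro CollectI conjI allI impI)
    show "sets \<mu> = sets borel" by (simp add: \<mu>_def)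
    have "Z \<inter> - {-1..1} = {}" using Z by auto
    then show "emeasure \<mu> (- {-1..1}) = 0" using em[of "- {-1..1}"] by simp
    fix p :: "real poly" assume p: "degree p \<le> 2 * n - 1"
    have bm: "poly p \<in> borel_measurable borel"
      by (intro borel_measurable_continuous_onI continuous_intros)
    show "integrable \<mu> (poly p)"
      unfolding \<mu>_def integrable_distr_eq[OF meas bm] unfolding M_def by (rule integrable_point_measure_finite[OF fin])
    have "(\<integral>t. poly p t \<partial>\<mu>) = (\<Sum>z\<in>Z. \<alpha> z * poly p z)"
      unfolding \<mu>_def integral_distr[OF meas bm] unfolding M_def
      using lebesgue_integral_point_measure_finite[OF fin, of \<alpha> "poly p"] nonneg by simp
    then show "(\<integral>t. poly p t \<partial>\<mu>) = integral {-1..1} (\<lambda>t. poly p t * w t)"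
      using exact[OF p] by (simp add: functional_def)
  qed
  moreover have "measure \<mu> A = (\<Sum>z\<in>Z \<inter> A. \<alpha> z)" if "A \<in> sets borel" for A
  proof -
    have "(\<Sum>z\<in>Z \<inter> A. ennreal (\<alpha> z)) = ennreal (\<Sum>z\<in>Z \<inter> A. \<alpha> z)"
      using nonneg by (intro sum_ennreal) auto
    moreover have "(\<Sum>z\<in>Z \<inter> A. \<alpha> z) \<ge> 0" using nonneg by (intro sum_nonneg) auto
    ultimately show ?thesis unfolding measure_def em[OF that] by simp
  qed
  ultimately show ?thesis by blast
qed

text \<open>A real \<open>Sup\<close> dominates its set only if the set is bounded above; the
  constant 1 majorises every indicator and supplies the bound.\<close>

lemma measure_le_pi_fun:
  assumes "\<mu> \<in> moment_measures w n"
  shows "measure \<mu> {-1..x} \<le> pi_fun w n x"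
  unfolding pi_fun_def
  by (rule cSup_upper, use assms in blast, intro bdd_aboveI2[of _ _ "functional 1"] measure_le_functional)
     (auto simp: indicator_def)

lemma measure_le_lambda_fun:
  assumes "\<mu> \<in> moment_measures w n"
  shows "measure \<mu> {x} \<le> lambda_fun w n x"
  unfolding lambda_fun_def
  by (rule cSup_upper, use assms in blast, intro bdd_aboveI2[of _ _ "functional 1"] measure_le_functional)
     (auto simp: indicator_def)

text \<open>Needed for upper bounds on the suprema; the canonical quadrature at the arbitrary
  interior point 0 is a witness.\<close>

lemma moment_measures_nonempty:
  assumes "n \<ge> 1"
  shows "moment_measures w n \<noteq> {}"
proof -
  have lt: "degree q < 2 * n \<longleftrightarrow> degree q \<le> 2 * n - 1" for q :: "real poly" using assms by linarith
  obtain Z \<alpha> where Z: "finite Z" "Z \<subseteq> {-1..1}" "\<And>z. z \<in> insert 0 Z \<Longrightarrow> \<alpha> z \<ge> (0::real)"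
    "\<And>q. degree q \<le> 2 * n - 1 \<Longrightarrow> functional q = (\<Sum>z\<in>insert 0 Z. \<alpha> z * poly q z)"
    using canonical_quadrature[of 0 "2 * n"] assms unfolding lt by auto
  show ?thesis
    using quadrature_moment_measure[of "insert 0 Z" \<alpha> n, OF _ _ Z(3,4)] Z(1,2) by auto
qed

lemma pi_fun_le_functional:
  assumes "n \<ge> 1" "degree Q < 2 * n"
    and "\<And>t. t \<in> {-1..y} \<Longrightarrow> poly Q t \<ge> 1" "\<And>t. t \<in> {y..1} \<Longrightarrow> poly Q t \<ge> 0"
  shows "pi_fun w n y \<le> functional Q"
proof -
  have "measure \<mu> {-1..y} \<le> functional Q" if "\<mu> \<in> moment_measures w n" for \<mu>
    by (rule measure_le_functional[OF that]) (use assms in \<open>auto simp: indicator_def\<close>)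
  then show ?thesis
    unfolding pi_fun_def using moment_measures_nonempty[OF assms(1)] by (intro cSup_least) auto
qed

text \<open>Both \<open>P\<close> and \<open>1 - P'\<close>, where \<open>P'\<close> is the majorant of the indicator of \<open>[x,1]\<close> with the same nodes,
  interpolate a step at \<open>x\<close>; the integral of their difference \<open>K\<close> is the mass of the quadrature at \<open>x\<close>.\<close>

lemma extremal_polynomials:
  assumes n: "n \<ge> 1" and x: "x \<in> {-1<..<1}"
  obtains P K \<alpha> where "degree P < 2 * n" "\<And>t. t \<in> {-1..x} \<Longrightarrow> poly P t \<ge> 1"
      "\<And>t. t \<in> {x..1} \<Longrightarrow> poly P t \<ge> 0" "functional P = pi_fun w n x" "poly P x = 1"
    and "degree K < 2 * n" "\<And>t. t \<in> {-1..1} \<Longrightarrow> poly K t \<ge> 0" "poly K x = 1" "functional K = \<alpha>"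
    and "\<alpha> \<le> lambda_fun w n x" "functional P - integral {-1..x} w \<le> \<alpha>"
      "\<And>T. degree T < 2 * n \<Longrightarrow> (\<And>t. t \<in> {-1..1} \<Longrightarrow> poly T t \<ge> 0) \<Longrightarrow> \<alpha> * poly T x \<le> functional T"
proof -
  have lt: "degree q < 2 * n \<longleftrightarrow> degree q \<le> 2 * n - 1" for q :: "real poly" using n by linarith
  obtain Z \<alpha> where Z: "finite Z" "Z \<subseteq> {-1..1}" "x \<notin> Z" "(\<Sum>z\<in>Z. node_mult z) < 2 * n"
    and \<alpha>: "\<And>z. z \<in> insert x Z \<Longrightarrow> \<alpha> z \<ge> (0::real)"
    and ex: "\<And>q. degree q < 2 * n \<Longrightarrow> functional q = (\<Sum>z\<in>insert x Z. \<alpha> z * poly q z)"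
  proof -
    have "0 < 2 * n" using n by simp
    from canonical_quadrature[OF x this] show ?thesis using that by blast
  qed
  have ex': "functional q = \<alpha> x * poly q x + (\<Sum>z\<in>Z. \<alpha> z * poly q z)" if "degree q < 2 * n" for q
    using ex[OF that] Z(1,3) by simp
  obtain P where P: "degree P \<le> 2 * n - 1" "\<forall>t\<in>{-1..x}. poly P t \<ge> 1" "\<forall>t\<in>{x..1}. poly P t \<ge> 0"
    "poly P x = 1" "\<forall>z\<in>Z. poly P z = (if z < x then 1 else 0)"
  proof -
    have "(\<Sum>z\<in>Z. node_mult z) \<le> 2 * n - 1" using Z(4) by linarith
    from step_majorant[OF Z(1,2) x Z(3) this] show ?thesis using that by blast
  qed
  have mult: "(\<Sum>z\<in>uminus ` Z. node_mult z) = (\<Sum>z\<in>Z. node_mult z)"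
    by (subst sum.reindex) (auto simp: inj_on_def node_mult_def)
  \<comment> \<open>The same construction for the reflected nodes and jump; composed with t -> -t it
    majorises the indicator of [x,1].\<close>
  obtain S where S: "degree S \<le> 2 * n - 1" "\<forall>t\<in>{-1..-x}. poly S t \<ge> 1" "\<forall>t\<in>{-x..1}. poly S t \<ge> 0"
    "poly S (-x) = 1" "\<forall>z\<in>uminus ` Z. poly S z = (if z < -x then 1 else 0)"
  proof -
    have "finite (uminus ` Z)" "uminus ` Z \<subseteq> {-1..1}" "-x \<in> {-1<..<1}" "-x \<notin> uminus ` Z"
      using Z(1-3) x by auto
    moreover have "(\<Sum>z\<in>uminus ` Z. node_mult z) \<le> 2 * n - 1"
      using Z(4) mult by linarith
    ultimately show ?thesis using step_majorant[of "uminus ` Z" "-x" "2 * n - 1"] that by blast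
  qed
  define P' where "P' = pcompose S [:0, -1:]"
  have poly_P': "poly P' t = poly S (- t)" for t by (simp add: P'_def poly_pcompose)
  have deg_P': "degree P' < 2 * n"
    using S(1) n by (simp add: P'_def degree_pcompose)
  define K where "K = P + P' - 1"
  have deg: "degree P < 2 * n" "degree K < 2 * n"
    using P(1) deg_P' n unfolding K_def by (auto intro!: degree_add_less degree_diff_less)
  have K_nodes: "poly K z = 0" if "z \<in> Z" for z
  proof -
    have "z \<noteq> x" using that Z(3) by auto
    moreover have "poly S (- z) = (if x < z then 1 else 0)" using S(5) that by auto
    ultimately show ?thesis using P(5) that by (auto simp: K_def poly_P')
  qed
  have K_nonneg: "poly K t \<ge> 0" if "t \<in> {-1..1}" for t
  proof (cases "t \<le> x")
    case True
    then have "poly P t \<ge> 1" "poly S (-t) \<ge> 0" using that P(2) S(3) by auto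
    then show ?thesis by (simp add: K_def poly_P')
  next
    case False
    then have "poly P t \<ge> 0" "poly S (-t) \<ge> 1" using that P(3) S(2) by auto
    then show ?thesis by (simp add: K_def poly_P')
  qed
  have Kx: "poly K x = 1" using P(4) S(4) by (simp add: K_def poly_P')
  have fK: "functional K = \<alpha> x" using ex'[OF deg(2)] K_nodes Kx by simp
  obtain \<mu> where \<mu>: "\<mu> \<in> moment_measures w n"
      "\<And>A. A \<in> sets borel \<Longrightarrow> measure \<mu> A = (\<Sum>z\<in>insert x Z \<inter> A. \<alpha> z)"
    using quadrature_moment_measure[of "insert x Z" \<alpha> n] Z(1,2) \<alpha> ex x unfolding lt by auto
  have "insert x Z \<inter> {x} = {x}" by auto
  then have "\<alpha> x \<le> lambda_fun w n x"
    using measure_le_lambda_fun[OF \<mu>(1), of x] \<mu>(2)[of "{x}"] by simp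
  moreover have "functional P = pi_fun w n x"
  proof (rule antisym)
    \<comment> \<open>On the nodes \<open>P\<close> coincides with the indicator of [-1,x], so the
      discrete measure attains the bound given by \<open>P\<close>.\<close>
    have "insert x Z \<inter> {-1..x} = {z \<in> insert x Z. z \<le> x}" using Z(2) x by auto
    then have "(\<Sum>z\<in>insert x Z \<inter> {-1..x}. \<alpha> z) = (\<Sum>z\<in>insert x Z. if z \<le> x then \<alpha> z else 0)"
      using Z(1) by (simp only: sum.inter_filter finite_insert)
    also have "\<dots> = (\<Sum>z\<in>insert x Z. \<alpha> z * poly P z)"
    proof (intro sum.cong refl)
      fix z assume "z \<in> insert x Z"
      then have "poly P z = (if z \<le> x then 1 else 0)"
        using P(4,5) Z(3) by (cases "z = x") (auto simp: less_le)
      then show "(if z \<le> x then \<alpha> z else 0) = \<alpha> z * poly P z" by simp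
    qed
    also have "\<dots> = functional P" using ex[OF deg(1)] by simp
    finally show "functional P \<le> pi_fun w n x"
      using measure_le_pi_fun[OF \<mu>(1), of x] \<mu>(2)[of "{-1..x}"] by simp
    show "pi_fun w n x \<le> functional P"
      using P deg n by (intro pi_fun_le_functional) auto
  qed
  moreover have "functional P - integral {-1..x} w \<le> \<alpha> x"
  proof -
    \<comment> \<open>Together the two majorants exceed the total integral by the mass at
      \<open>x\<close>. Each exceeds its own half, so neither excess is larger than that
      mass.\<close>
    have "functional P + functional P' = functional 1 + \<alpha> x"
      using fK by (simp add: K_def functional_add functional_diff)
    moreover have "functional 1 = integral {-1..x} w + integral {x..1} w"
      using Henstock_Kurzweil_Integration.integral_combine[of "-1" x 1 w] w_integrable[of "-1" 1] x
      by (simp add: functional_def)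
    moreover have "integral {x..1} w \<le> functional P'"
    proof -
      have "integral {x..1} w \<le> integral {x..1} (\<lambda>t. poly P' t * w t)"
      proof (rule integral_le)
        fix t assume t: "t \<in> {x..1}"
        then have "poly P' t \<ge> 1" "w t \<ge> 0"
          using S(2) x w_ge[of t] m_pos by (auto simp: poly_P')
        then show "w t \<le> poly P' t * w t"
          using mult_right_mono[of 1 "poly P' t" "w t"] by simp
      qed (use x w_integrable poly_w_integrable in auto)
      also have "\<dots> \<le> functional P'"
        unfolding functional_def
      proof (intro integral_subset_le ballI)
        fix t :: real assume t: "t \<in> {-1..1}"
        have "poly P' t \<ge> 0"
        proof (cases "t \<le> x")
          case True
          then show ?thesis using S(3) t by (auto simp: poly_P')
        next
          case False
          then have "poly S (-t) \<ge> 1" using S(2) t by auto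
          then show ?thesis by (simp add: poly_P')
        qed
        moreover have "w t \<ge> 0" using w_ge[OF t] m_pos by simp
        ultimately show "0 \<le> poly P' t * w t" by simp
      qed (use x poly_w_integrable in auto)
      finally show ?thesis .
    qed
    ultimately show ?thesis by linarith
  qed
  moreover have "\<alpha> x * poly T x \<le> functional T"
    if T: "degree T < 2 * n" "\<And>t. t \<in> {-1..1} \<Longrightarrow> poly T t \<ge> 0" for T
  proof -
    \<comment> \<open>Dropping the other nodes, whose contributions are nonnegative, leaves the term
      at \<open>x\<close>.\<close>
    have "(\<Sum>z\<in>Z. \<alpha> z * poly T z) \<ge> 0"
      using T(2) Z(2) \<alpha> by (intro sum_nonneg mult_nonneg_nonneg) auto
    then show ?thesis using ex'[OF T(1)] by simp
  qed
  ultimately show ?thesis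
    using that[of P K "\<alpha> x"] deg P(2-4) K_nonneg Kx fK by blast
qed

end

section \<open>Derivative bounds\<close>

lemma right_derivative_nonneg:
  fixes f :: "real \<Rightarrow> real"
  assumes "(f has_real_derivative D) (at a)" "f a = 0" "\<delta> > 0"
    and "\<And>s. a < s \<Longrightarrow> s < a + \<delta> \<Longrightarrow> f s \<ge> 0"
  shows "D \<ge> 0"
proof (rule ccontr)
  assume "\<not> D \<ge> 0"
  then obtain d where d: "d > 0" "\<And>h. h > 0 \<Longrightarrow> h < d \<Longrightarrow> f (a + h) < f a"
    using has_real_derivative_neg_dec_right[OF assms(1)] by auto
  have "f (a + min d \<delta> / 2) < f a" using d(1) assms(3) by (intro d(2)) auto
  moreover have "f (a + min d \<delta> / 2) \<ge> 0" using d(1) assms(3) by (intro assms(4)) auto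
  ultimately show False using assms(2) by simp
qed

section \<open>A test polynomial of Fejer type\<close>

definition dirichlet_poly :: "nat \<Rightarrow> real poly" where
  "dirichlet_poly k = 1 + smult 2 (\<Sum>j<k. cheb_T (Suc j))"

text \<open>At cos a this is n times the Fejer kernel, (sin (n a / 2) / sin (a / 2))^2, with peak
  value n^2 at t = 1.\<close>

definition fejer_poly :: "nat \<Rightarrow> real poly" where
  "fejer_poly n = (\<Sum>k<n. dirichlet_poly k)"

lemma degree_fejer_poly: "degree (fejer_poly n) \<le> n - 1"
  unfolding fejer_poly_def
proof (rule degree_sum_le)
  fix k assume k: "k \<in> {..<n}"
  have "degree (\<Sum>j<k. cheb_T (Suc j)) \<le> n - 1"
  proof (rule degree_sum_le)
    fix j assume "j \<in> {..<k}"
    then show "degree (cheb_T (Suc j)) \<le> n - 1"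
      using k conjunct1[OF cheb_T_coeff[of "Suc j"]] by (simp del: cheb_T.simps)
  qed auto
  then show "degree (dirichlet_poly k) \<le> n - 1"
    unfolding dirichlet_poly_def by (intro degree_add_le order.trans[OF degree_smult_le]) auto
qed auto

lemma dirichlet_poly_telescope:
  "(1 - t) * poly (dirichlet_poly k) t = poly (cheb_T k) t - poly (cheb_T (Suc k)) t"
proof (induction k)
  case 0
  then show ?case by (simp add: dirichlet_poly_def)
next
  case (Suc k)
  have "(1 - t) * poly (dirichlet_poly (Suc k)) t
      = (1 - t) * poly (dirichlet_poly k) t + 2 * (1 - t) * poly (cheb_T (Suc k)) t"
    by (simp add: dirichlet_poly_def algebra_simps)
  also have "\<dots> = poly (cheb_T (Suc k)) t - poly (cheb_T (Suc (Suc k))) t"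
    unfolding Suc by (simp add: algebra_simps)
  finally show ?case .
qed

lemma fejer_poly_telescope: "(1 - t) * poly (fejer_poly n) t = 1 - poly (cheb_T n) t"
proof (induction n)
  case (Suc n)
  have "(1 - t) * poly (fejer_poly (Suc n)) t
      = (1 - t) * poly (fejer_poly n) t + (1 - t) * poly (dirichlet_poly n) t"
    by (simp add: fejer_poly_def distrib_left)
  then show ?case using Suc dirichlet_poly_telescope[of t n] by simp
qed (simp add: fejer_poly_def)

lemma fejer_poly_abs_le:
  assumes "t \<in> {-1..1}"
  shows "\<bar>poly (fejer_poly n) t\<bar> \<le> real n ^ 2"
proof -
  have D: "\<bar>poly (dirichlet_poly k) t\<bar> \<le> 2 * real k + 1" for k
  proof -
    have "\<bar>\<Sum>j<k. poly (cheb_T (Suc j)) t\<bar> \<le> (\<Sum>j<k. 1)"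
      using cheb_T_bound[OF assms] by (intro order.trans[OF sum_abs] sum_mono) auto
    then show ?thesis by (simp add: dirichlet_poly_def poly_sum)
  qed
  show ?thesis
  proof (induction n)
    case (Suc n)
    have "poly (fejer_poly (Suc n)) t = poly (fejer_poly n) t + poly (dirichlet_poly n) t"
      by (simp add: fejer_poly_def)
    then show ?case using Suc D[of n] by (simp add: power2_eq_square algebra_simps)
  qed (simp add: fejer_poly_def)
qed

text \<open>Within 1 / (2 n^2) of the point 1 the Lipschitz bound keeps every T_j with j <= n above
  1/2, so half of the peak value survives.\<close>

lemma fejer_poly_ge:
  assumes t: "t \<in> {-1..1}" and n: "2 * real n ^ 2 * (1 - t) \<le> 1"
  shows "poly (fejer_poly n) t \<ge> real n ^ 2 / 2"
proof -
  have T: "poly (cheb_T j) t \<ge> 1 / 2" if "j \<le> n" for j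
  proof -
    have "poly (cheb_T j) 1 = 1" using poly_cheb_T_cos[of j 0] by simp
    moreover have "real j ^ 2 * (1 - t) \<le> real n ^ 2 * (1 - t)"
      using t that by (intro mult_right_mono power_mono) auto
    ultimately show ?thesis
      using cheb_T_lipschitz[of 1 t j] t n by auto
  qed
  have D: "poly (dirichlet_poly k) t \<ge> real k + 1" if "k < n" for k
  proof -
    have "(\<Sum>j<k. poly (cheb_T (Suc j)) t) \<ge> (\<Sum>j<k. 1 / 2)"
      using that by (intro sum_mono T) auto
    then show ?thesis by (simp add: dirichlet_poly_def poly_sum)
  qed
  have "poly (fejer_poly k) t \<ge> real k ^ 2 / 2" if "k \<le> n" for k
    using that
  proof (induction k)
    case (Suc k)
    have "poly (fejer_poly (Suc k)) t = poly (fejer_poly k) t + poly (dirichlet_poly k) t"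
      by (simp add: fejer_poly_def)
    then show ?case using Suc D[of k] by (simp add: power2_eq_square field_simps)
  qed (simp add: fejer_poly_def)
  then show ?thesis by simp
qed

text \<open>The bounds N near the peak and 2 / (1 + t) away from it combine into 3 N / (1 + N (1 +
  t)), whose square has an explicit antiderivative.\<close>

lemma integral_fejer_poly_square:
  assumes "n \<ge> 1"
  shows "integral {-1..1} (\<lambda>t. poly (fejer_poly n) (- t) ^ 2) \<le> 9 * real n ^ 2"
proof -
  define N where "N = real n ^ 2"
  have N: "N \<ge> 1" using assms by (simp add: N_def)
  have pos: "1 + N * (1 + t) > 0" if "t \<in> {-1..1}" for t
    using N that by (simp add: add_pos_nonneg)
  have "((\<lambda>t. 9 * N ^ 2 / (1 + N * (1 + t)) ^ 2) has_integral
      (- 9 * N / (1 + N * (1 + 1)) - - 9 * N / (1 + N * (1 + (-1))))) {-1..1}"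
  proof (rule fundamental_theorem_of_calculus)
    fix t :: real assume t: "t \<in> {-1..1}"
    have "((\<lambda>t. - 9 * N / (1 + N * (1 + t))) has_real_derivative 9 * N ^ 2 / (1 + N * (1 + t)) ^ 2) (at t within {-1..1})"
      using pos[OF t] by (auto intro!: derivative_eq_intros simp: power2_eq_square)
    then show "((\<lambda>t. - 9 * N / (1 + N * (1 + t))) has_vector_derivative 9 * N ^ 2 / (1 + N * (1 + t)) ^ 2) (at t within {-1..1})"
      by (simp add: has_real_derivative_iff_has_vector_derivative)
  qed simp
  moreover have "- 9 * N / (1 + N * (1 + 1)) - - 9 * N / (1 + N * (1 + (-1))) \<le> 9 * N"
    using N by simp
  ultimately have maj: "(\<lambda>t. 9 * N ^ 2 / (1 + N * (1 + t)) ^ 2) integrable_on {-1..1}"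
      "integral {-1..1} (\<lambda>t. 9 * N ^ 2 / (1 + N * (1 + t)) ^ 2) \<le> 9 * N"
    by (auto simp: integral_unique has_integral_integrable)
  have "integral {-1..1} (\<lambda>t. poly (fejer_poly n) (- t) ^ 2)
     \<le> integral {-1..1} (\<lambda>t. 9 * N ^ 2 / (1 + N * (1 + t)) ^ 2)"
  proof (rule integral_le)
    show "(\<lambda>t. poly (fejer_poly n) (- t) ^ 2) integrable_on {-1..1}"
      by (intro integrable_continuous_real continuous_intros)
    fix t :: real assume t: "t \<in> {-1..1}"
    define f where "f = \<bar>poly (fejer_poly n) (- t)\<bar>"
    have f: "f \<le> N" "f \<ge> 0" using fejer_poly_abs_le[of "-t" n] t by (auto simp: f_def N_def)
    have "f * (1 + t) = \<bar>1 - poly (cheb_T n) (- t)\<bar>"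
      using fejer_poly_telescope[of "-t" n] t by (simp add: f_def abs_mult flip: fejer_poly_telescope)
    also have "\<dots> \<le> 2" using cheb_T_bound[of "-t" n] t by auto
    finally have "N * (f * (1 + t)) \<le> N * 2" using N by (intro mult_left_mono) auto
    then have "f * (1 + N * (1 + t)) \<le> 3 * N" using f by (simp add: algebra_simps)
    then have "f \<le> 3 * N / (1 + N * (1 + t))" using pos[OF t] by (simp add: pos_le_divide_eq)
    then have "f ^ 2 \<le> (3 * N / (1 + N * (1 + t))) ^ 2" using f(2) by (intro power_mono)
    then show "poly (fejer_poly n) (- t) ^ 2 \<le> 9 * N ^ 2 / (1 + N * (1 + t)) ^ 2"
      by (simp add: f_def power_divide power_mult_distrib)
  qed (rule maj)
  then show ?thesis using maj(2) by (simp add: N_def)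
qed

context lipschitz_weight
begin

lemma w_le: "t \<in> {-1..1} \<Longrightarrow> w t \<le> w 1 + 2 * R"
proof -
  assume t: "t \<in> {-1..1}"
  have "w t - w 1 \<le> R * \<bar>t - 1\<bar>" using w_lipschitz[OF t, of 1] by auto
  also have "\<dots> \<le> R * 2" using t R_pos by (intro mult_left_mono) auto
  finally show ?thesis by simp
qed

text \<open>The squared Fejer polynomial, reflected to peak at -1, is at least n^4 / 4 at
  \<open>x\<close>, while its weighted integral is at most 9 n^2 times an upper bound for the
  weight.\<close>

lemma endpoint_mass_bound:
  assumes n: "n \<ge> 1" and x: "x \<in> {-1..1}" "2 * real n ^ 2 * (1 + x) \<le> 1"
    and \<alpha>: "\<alpha> \<ge> 0"
      "\<And>T. degree T < 2 * n \<Longrightarrow> (\<And>t. t \<in> {-1..1} \<Longrightarrow> poly T t \<ge> 0) \<Longrightarrow> \<alpha> * poly T x \<le> functional T"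
  shows "\<alpha> * real n ^ 2 \<le> 36 * (w 1 + 2 * R)"
proof -
  define W where "W = w 1 + 2 * R"
  have W: "W > 0" using w_ge[of 1] m_pos R_pos by (simp add: W_def)
  define T where "T = pcompose (fejer_poly n) [:0, -1:] ^ 2"
  have T: "poly T t = poly (fejer_poly n) (- t) ^ 2" for t
    by (simp add: T_def poly_pcompose)
  have "degree T \<le> degree (pcompose (fejer_poly n) [:0, -1:]) * 2"
    unfolding T_def by (rule degree_power_le)
  then have "degree T < 2 * n" using degree_fejer_poly[of n] n by (simp add: degree_pcompose)
  then have "\<alpha> * poly T x \<le> functional T" by (intro \<alpha>(2)) (simp_all add: T)
  also have "functional T \<le> integral {-1..1} (\<lambda>t. poly T t * W)"
    unfolding functional_def
  proof (rule integral_le)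
    show "(\<lambda>t. poly T t * W) integrable_on {-1..1}"
      by (intro integrable_continuous_real continuous_intros)
    fix t :: real assume "t \<in> {-1..1}"
    then show "poly T t * w t \<le> poly T t * W"
      using w_le by (intro mult_left_mono) (auto simp: W_def T)
  qed (use poly_w_integrable in auto)
  also have "\<dots> \<le> 9 * real n ^ 2 * W"
    using integral_fejer_poly_square[OF n] W by (simp add: T)
  finally have 1: "\<alpha> * poly T x \<le> 9 * real n ^ 2 * W" .
  have "real n ^ 2 / 2 \<le> poly (fejer_poly n) (- x)"
    using x by (intro fejer_poly_ge) auto
  then have "(real n ^ 2 / 2) ^ 2 \<le> poly T x"
    unfolding T by (intro power_mono) auto
  then have "\<alpha> * (real n ^ 2 / 2) ^ 2 \<le> \<alpha> * poly T x"
    using \<alpha>(1) by (rule mult_left_mono)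
  with 1 have "real n ^ 2 * (\<alpha> * real n ^ 2) \<le> real n ^ 2 * (36 * W)"
    by (simp add: power2_eq_square field_simps)
  then show ?thesis using n by (simp add: W_def)
qed

lemma has_integral_w_restrict:
  assumes "y \<in> {-1..1}"
  shows "((\<lambda>t. if t \<le> y then w t else 0) has_integral integral {-1..y} w) {-1..1}"
proof -
  have "((\<lambda>t. if t \<in> {-1..y} then w t else 0) has_integral integral {-1..y} w) {-1..1}"
    using assms w_integrable[of "-1" y]
    by (subst has_integral_restrict) (auto simp: integrable_integral)
  then show ?thesis by (rule has_integral_eq[rotated]) auto
qed

text \<open>The dilation towards the endpoint \<open>e\<close> maps \<open>[-1,1]\<close> into itself and moves the jump from \<open>y\<close>
  to \<open>x\<close>, so it turns the extremal polynomial for \<open>x\<close> into a competitor for \<open>y\<close>.\<close>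

lemma pi_fun_dilation_le:
  assumes n: "n \<ge> 1" and x: "x \<in> {-1<..<1}" and P: "degree P < 2 * n"
      "\<And>t. t \<in> {-1..x} \<Longrightarrow> poly P t \<ge> 1" "\<And>t. t \<in> {x..1} \<Longrightarrow> poly P t \<ge> 0"
    and e: "\<bar>e\<bar> = 1" and s: "0 < s" "s < 1" and y: "y = (x - s * e) / (1 - s)" "y \<in> {-1..1}"
  shows "pi_fun w n y \<le> integral {-1..y} w
     + (functional P - integral {-1..x} w) * (1 + 2 * R * s / (m * (1 - s))) / (1 - s)"
proof -
  define \<phi> where "\<phi> t = (1 - s) * t + s * e" for t
  define \<psi> where "\<psi> u = (u - s * e) / (1 - s)" for u
  \<comment> \<open>The nonnegative excess over the indicator: the claim compares the weighted
    integrals of \<open>D\<close> and of its dilate.\<close>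
  define D where "D u = poly P u - (if u \<le> x then 1 else 0)" for u
  define Q where "Q = pcompose P [:s * e, 1 - s:]"
  \<comment> \<open>The dilation moves a point by at most 2 s / (1 - s); by the Lipschitz bound and
    w >= m, the weight then grows by at most the factor \<open>c\<close>.\<close>
  define c where "c = 1 + 2 * R * s / (m * (1 - s))"
  have \<phi>_mem: "\<phi> t \<in> {-1..1}" if "t \<in> {-1..1}" for t
  proof -
    have "\<bar>\<phi> t\<bar> \<le> (1 - s) * \<bar>t\<bar> + s * \<bar>e\<bar>"
      unfolding \<phi>_def using s by (intro order.trans[OF abs_triangle_ineq]) (simp add: abs_mult)
    also have "\<dots> \<le> (1 - s) * 1 + s * 1"
      using s e that by (intro add_mono mult_left_mono) auto
    finally show ?thesis by (auto simp: abs_le_iff)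
  qed
  have \<phi>\<psi>: "\<phi> (\<psi> u) = u" for u using s by (simp add: \<phi>_def \<psi>_def)
  have \<phi>_le: "\<phi> t \<le> x \<longleftrightarrow> t \<le> y" for t
    using s by (simp add: \<phi>_def y(1) pos_le_divide_eq algebra_simps)
  have polyQ: "poly Q t = poly P (\<phi> t)" for t
    by (simp add: Q_def poly_pcompose \<phi>_def algebra_simps)
  have D: "D u \<ge> 0" if "u \<in> {-1..1}" for u
    using P(2)[of u] P(3)[of u] that by (auto simp: D_def)
  have "pi_fun w n y \<le> functional Q"
  proof (rule pi_fun_le_functional[OF n])
    show "degree Q < 2 * n"
      using P(1) s by (simp add: Q_def degree_pcompose)
    show "1 \<le> poly Q t" if "t \<in> {-1..y}" for t
      using \<phi>_mem[of t] \<phi>_le[of t] that y(2) by (auto simp: polyQ intro: P(2))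
    show "0 \<le> poly Q t" if "t \<in> {y..1}" for t
    proof (cases "t = y")
      case True
      then show ?thesis using P(2)[of x] x y s by (simp add: polyQ \<phi>_def)
    next
      case False
      then show ?thesis using \<phi>_mem[of t] \<phi>_le[of t] that y(2) by (auto simp: polyQ intro: P(3))
    qed
  qed
  also have "functional Q - integral {-1..y} w
      \<le> (functional P - integral {-1..x} w) * c / (1 - s)"
  proof -
    have "((\<lambda>t. poly Q t * w t - (if t \<le> y then w t else 0)) has_integral
        functional Q - integral {-1..y} w) {-1..1}"
      unfolding functional_def using poly_w_integrable y(2)
      by (intro has_integral_diff integrable_integral has_integral_w_restrict) auto
    then have "((\<lambda>t. D (\<phi> t) * w t) has_integral functional Q - integral {-1..y} w) {-1..1}"
      by (rule has_integral_eq[rotated]) (auto simp: D_def polyQ \<phi>_le algebra_simps)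
    then have "((\<lambda>t. D (\<phi> t) * w t) has_integral functional Q - integral {-1..y} w) (cbox (-1) 1)"
      by simp
    \<comment> \<open>Substituting t = \<open>\<psi> u\<close> brings in the factor 1 - s and
      restricts the domain to the image of [-1,1] under \<open>\<phi>\<close>.\<close>
    moreover have "(1 / (1 - s)) *\<^sub>R u + - s * e / (1 - s) = \<psi> u" for u
      by (simp add: \<psi>_def diff_divide_distrib)
    moreover have "(b - - s * e / (1 - s)) /\<^sub>R (1 / (1 - s)) = \<phi> b" for b
    proof -
      have "(b - - s * e / (1 - s)) /\<^sub>R (1 / (1 - s)) = (1 - s) * (b + s * e / (1 - s))"
        by simp
      also have "\<dots> = \<phi> b" using s by (simp add: \<phi>_def distrib_left)
      finally show ?thesis .
    qed
    moreover have "i /\<^sub>R (1 / (1 - s)) ^ DIM(real) = (1 - s) * i" for i :: real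
      by simp
    moreover have "1 / (1 - s) > 0" using s by simp
    ultimately
    have "((\<lambda>u. D (\<phi> (\<psi> u)) * w (\<psi> u)) has_integral (1 - s) * (functional Q - integral {-1..y} w))
        {\<phi> (-1)..\<phi> 1}"
      using has_integral_affinity'[of "\<lambda>t. D (\<phi> t) * w t" "functional Q - integral {-1..y} w" "-1" 1
          "1 / (1 - s)" "- s * e / (1 - s)"]
      by (simp only: cbox_interval)
    then have 1: "((\<lambda>u. D u * w (\<psi> u)) has_integral (1 - s) * (functional Q - integral {-1..y} w))
        {\<phi> (-1)..\<phi> 1}"
      by (simp only: \<phi>\<psi>)
    have "((\<lambda>t. poly P t * w t - (if t \<le> x then w t else 0)) has_integral
        functional P - integral {-1..x} w) {-1..1}"
      unfolding functional_def using poly_w_integrable x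
      by (intro has_integral_diff integrable_integral has_integral_w_restrict) auto
    then have 2: "((\<lambda>t. D t * w t) has_integral functional P - integral {-1..x} w) {-1..1}"
      by (rule has_integral_eq[rotated]) (auto simp: D_def algebra_simps)
    have sub: "{\<phi> (-1)..\<phi> 1} \<subseteq> {-1..1}" using \<phi>_mem[of "-1"] \<phi>_mem[of 1] by auto
    have int3: "(\<lambda>t. c * (D t * w t)) integrable_on {-1..1}"
      by (rule has_integral_integrable[OF has_integral_mult_right[OF 2]])
    have c: "c \<ge> 0" using R_pos m_pos s by (simp add: c_def)
    have "integral {\<phi> (-1)..\<phi> 1} (\<lambda>u. D u * w (\<psi> u)) \<le> integral {\<phi> (-1)..\<phi> 1} (\<lambda>u. c * (D u * w u))"
    proof (rule integral_le)
      show "(\<lambda>u. D u * w (\<psi> u)) integrable_on {\<phi> (-1)..\<phi> 1}" using 1 by (rule has_integral_integrable)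
      show "(\<lambda>u. c * (D u * w u)) integrable_on {\<phi> (-1)..\<phi> 1}"
        by (rule integrable_subinterval_real[OF int3 sub])
      fix u assume u: "u \<in> {\<phi> (-1)..\<phi> 1}"
      have u1: "u \<in> {-1..1}" using u sub by blast
      have \<psi>1: "\<psi> u \<in> {-1..1}"
        using u s by (auto simp: \<phi>_def \<psi>_def pos_le_divide_eq pos_divide_le_eq algebra_simps)
      have "\<psi> u - u = (u - e) * (s / (1 - s))"
        using s by (simp add: \<psi>_def field_simps)
      then have "\<bar>\<psi> u - u\<bar> \<le> 2 * (s / (1 - s))"
        using s u1 e by (simp only: abs_mult) (intro mult_mono, auto)
      then have "R * \<bar>\<psi> u - u\<bar> \<le> R * (2 * (s / (1 - s)))"
        using R_pos by (intro mult_left_mono) auto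
      then have "w (\<psi> u) \<le> w u + R * (2 * (s / (1 - s)))"
        using w_lipschitz[OF \<psi>1 u1] by linarith
      also have "R * (2 * (s / (1 - s))) = m * (2 * R * s / (m * (1 - s)))"
        using m_pos s by simp
      also have "\<dots> \<le> w u * (2 * R * s / (m * (1 - s)))"
        using w_ge[OF u1] R_pos m_pos s by (intro mult_right_mono) auto
      finally have "w (\<psi> u) \<le> c * w u" by (simp add: c_def algebra_simps)
      then show "D u * w (\<psi> u) \<le> c * (D u * w u)"
        using mult_left_mono[OF _ D[OF u1], of "w (\<psi> u)" "c * w u"] by (simp add: ac_simps)
    qed
    also have "\<dots> \<le> integral {-1..1} (\<lambda>u. c * (D u * w u))"
    proof (intro integral_subset_le[OF sub _ int3] ballI)
      show "(\<lambda>u. c * (D u * w u)) integrable_on {\<phi> (-1)..\<phi> 1}"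
        by (rule integrable_subinterval_real[OF int3 sub])
      fix u :: real assume "u \<in> {-1..1}"
      then have "D u \<ge> 0" "w u \<ge> 0" using D w_ge[of u] m_pos by auto
      then show "0 \<le> c * (D u * w u)" using c by simp
    qed
    also have "\<dots> = c * (functional P - integral {-1..x} w)"
      using integral_unique[OF 2] by simp
    finally have "(1 - s) * (functional Q - integral {-1..y} w) \<le> c * (functional P - integral {-1..x} w)"
      using integral_unique[OF 1] by simp
    then show ?thesis using s by (simp add: pos_le_divide_eq mult.commute)
  qed
  finally show ?thesis by (simp add: c_def)
qed

text \<open>At s = 0 the dilation bound is an equality, so its slack \<open>H\<close> has
  nonnegative derivative there; the moving point has velocity x - e. As x - e changes sign between e
  = 1 and e = -1, the two choices bound the derivative from both sides.\<close>

lemma pi_fun_derivative_dilation: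
  assumes n: "n \<ge> 1" and x: "x \<in> {-1<..<1}" and P: "degree P < 2 * n"
      "\<And>t. t \<in> {-1..x} \<Longrightarrow> poly P t \<ge> 1" "\<And>t. t \<in> {x..1} \<Longrightarrow> poly P t \<ge> 0"
      "functional P = pi_fun w n x"
    and e: "\<bar>e\<bar> = 1"
    and d: "(pi_fun w n has_real_derivative p) (at x)"
  shows "(x - e) * (p - w x) \<le> (1 + 2 * R / m) * (functional P - integral {-1..x} w)"
proof -
  define y where "y s = (x - s * e) / (1 - s)" for s
  define E where "E = functional P - integral {-1..x} w"
  define H where "H s = integral {-1..y s} w + E * (1 + 2 * R * s / (m * (1 - s))) / (1 - s) - pi_fun w n (y s)" for s
  have y': "(y has_real_derivative x - e) (at 0)"
    unfolding y_def by (auto intro!: derivative_eq_intros)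
  have y0: "y 0 = x" by (simp add: y_def)
  have I: "((\<lambda>u. integral {-1..u} w) has_real_derivative w x) (at x)"
  proof -
    have "((\<lambda>u. integral {-1..u} w) has_real_derivative w x) (at x within {-1..1})"
      using x by (intro integral_has_real_derivative continuous_w) auto
    then show ?thesis using x by (simp add: at_within_Icc_at)
  qed
  have "((\<lambda>s. integral {-1..y s} w) has_real_derivative w x * (x - e)) (at 0)"
    using DERIV_chain2[of "\<lambda>u. integral {-1..u} w" "w x" y 0, OF _ y'] I y0 by simp
  moreover have "((\<lambda>s. pi_fun w n (y s)) has_real_derivative p * (x - e)) (at 0)"
    using DERIV_chain2[of "pi_fun w n" p y 0, OF _ y'] d y0 by simp
  moreover have "((\<lambda>s. E * (1 + 2 * R * s / (m * (1 - s))) / (1 - s)) has_real_derivative E * (1 + 2 * R / m)) (at 0)"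
    using m_pos by (auto intro!: derivative_eq_intros simp: field_simps power2_eq_square)
  ultimately have H': "(H has_real_derivative w x * (x - e) + E * (1 + 2 * R / m) - p * (x - e)) (at 0)"
    unfolding H_def by (intro DERIV_add DERIV_diff)
  have "y \<midarrow>0\<rightarrow> x" using DERIV_isCont[OF y'] y0 by (simp add: isCont_def)
  then have "eventually (\<lambda>s. y s \<in> {-1<..<1}) (at 0)"
    using x by (intro topological_tendstoD) auto
  then obtain d0 where d0: "d0 > 0" "\<And>s. s \<noteq> 0 \<Longrightarrow> \<bar>s\<bar> < d0 \<Longrightarrow> y s \<in> {-1<..<1}"
    by (auto simp: eventually_at dist_real_def)
  have "w x * (x - e) + E * (1 + 2 * R / m) - p * (x - e) \<ge> 0"
  proof (rule right_derivative_nonneg[OF H'])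
    show "H 0 = 0" using P(4) y0 by (simp add: H_def E_def)
    show "min d0 1 > 0" using d0 by simp
    fix s :: real assume s: "0 < s" "s < 0 + min d0 1"
    have "pi_fun w n (y s) \<le> integral {-1..y s} w + E * (1 + 2 * R * s / (m * (1 - s))) / (1 - s)"
      unfolding E_def
      by (rule pi_fun_dilation_le[OF n x P(1-3) e]) (use s d0(2)[of s] in \<open>auto simp: y_def\<close>)
    then show "H s \<ge> 0" by (simp add: H_def)
  qed
  then show ?thesis by (simp add: E_def algebra_simps)
qed

text \<open>For y slightly to the right of \<open>x\<close>, \<open>P\<close> falls below 1 on [x,y]
  by at most L (y - x). Since \<open>K\<close> exceeds 1/2 near \<open>x\<close>, adding 2 L (y - x)
  K repairs this, and the cost is linear in y - x.\<close>

lemma pi_fun_derivative_le_lipschitz: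
  assumes n: "n \<ge> 1" and x: "x \<in> {-1<..<1}" and P: "degree P < 2 * n"
      "\<And>t. t \<in> {-1..x} \<Longrightarrow> poly P t \<ge> 1" "\<And>t. t \<in> {x..1} \<Longrightarrow> poly P t \<ge> 0"
      "functional P = pi_fun w n x" "poly P x = 1"
    and K: "degree K < 2 * n" "\<And>t. t \<in> {-1..1} \<Longrightarrow> poly K t \<ge> 0" "poly K x = 1"
    and L: "L \<ge> 0" "\<And>t. t \<in> {-1..1} \<Longrightarrow> \<bar>poly P x - poly P t\<bar> \<le> L * \<bar>x - t\<bar>"
    and d: "(pi_fun w n has_real_derivative p) (at x)"
  shows "p \<le> 2 * L * functional K"
proof -
  have "isCont (poly K) x" by (intro continuous_intros)
  then have "eventually (\<lambda>t. poly K t > 1 / 2) (at x)"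
    using K(3) by (intro order_tendstoD(1)[of "poly K" 1]) (auto simp: isCont_def)
  then obtain d0 where d0: "d0 > 0" "\<And>t. t \<noteq> x \<Longrightarrow> \<bar>t - x\<bar> < d0 \<Longrightarrow> poly K t > 1 / 2"
    by (auto simp: eventually_at dist_real_def)
  define H where "H y = 2 * L * (y - x) * functional K + functional P - pi_fun w n y" for y
  have "(H has_real_derivative 2 * L * functional K - p) (at x)"
    unfolding H_def using d by (auto intro!: derivative_eq_intros)
  then have "2 * L * functional K - p \<ge> 0"
  proof (rule right_derivative_nonneg)
    show "H x = 0" using P(4) by (simp add: H_def)
    show "min d0 (1 - x) > 0" using d0 x by simp
    fix y assume y: "x < y" "y < x + min d0 (1 - x)"
    define Q where "Q = P + smult (2 * L * (y - x)) K"
    have "pi_fun w n y \<le> functional Q"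
    proof (rule pi_fun_le_functional[OF n])
      show "degree Q < 2 * n"
        unfolding Q_def using P(1) K(1) le_less_trans[OF degree_smult_le] by (intro degree_add_less)
      have Kt: "2 * L * (y - x) * poly K t \<ge> 0" if "t \<in> {-1..1}" for t
        using K(2)[OF that] L(1) y by simp
      show "1 \<le> poly Q t" if t: "t \<in> {-1..y}" for t
      proof (cases "t \<le> x")
        case True
        then show ?thesis using P(2)[of t] Kt[of t] t x by (simp add: Q_def)
      next
        case False
        then have "poly K t > 1 / 2" using d0(2)[of t] t y by auto
        then have "2 * L * (y - x) * (1 / 2) \<le> 2 * L * (y - x) * poly K t"
          using L(1) y by (intro mult_left_mono) auto
        moreover have "L * \<bar>x - t\<bar> \<le> L * (y - x)"
          using False t L(1) by (intro mult_left_mono) auto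
        moreover have "\<bar>poly P x - poly P t\<bar> \<le> L * \<bar>x - t\<bar>"
          using False t x y by (intro L(2)) auto
        ultimately show ?thesis using P(5) by (simp add: Q_def)
      qed
      show "0 \<le> poly Q t" if t: "t \<in> {y..1}" for t
        using P(3)[of t] Kt[of t] t y x by (simp add: Q_def)
    qed
    then show "H y \<ge> 0" by (simp add: H_def Q_def functional_add functional_smult)
  qed
  then show ?thesis by simp
qed

text \<open>In \<open>C\<close>, the 2 in 2 c comes from comparing 1 / (1 + x) with the minimum away
  from -1. Near -1, 1184 = 2 * 16 * 37, with 16 from (2 n)^4 and 37 = 1 + 36 from the bound on the
  integral of \<open>P\<close>.\<close>

lemma pi_fun_derivative_bounds:
  assumes n: "n \<ge> 1" and x: "x \<in> {-1<..<1}" and d: "(pi_fun w n has_real_derivative p) (at x)"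
  defines "c \<equiv> 1 + 2 * R / m" and "W \<equiv> w 1 + 2 * R"
  defines "C \<equiv> 2 * c + 1184 * W / m"
  shows "- C * lambda_fun w n x / (1 - x) \<le> p - w x"
    and "p - w x \<le> C * lambda_fun w n x * min (1 / (1 + x)) (real n ^ 2)"
proof -
  obtain P K \<alpha> where P: "degree P < 2 * n" "\<And>t. t \<in> {-1..x} \<Longrightarrow> poly P t \<ge> 1"
      "\<And>t. t \<in> {x..1} \<Longrightarrow> poly P t \<ge> 0" "functional P = pi_fun w n x" "poly P x = 1"
    and K: "degree K < 2 * n" "\<And>t. t \<in> {-1..1} \<Longrightarrow> poly K t \<ge> 0" "poly K x = 1" "functional K = \<alpha>"
    and \<alpha>: "\<alpha> \<le> lambda_fun w n x" "functional P - integral {-1..x} w \<le> \<alpha>"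
      "\<And>T. degree T < 2 * n \<Longrightarrow> (\<And>t. t \<in> {-1..1} \<Longrightarrow> poly T t \<ge> 0) \<Longrightarrow> \<alpha> * poly T x \<le> functional T"
    by (rule extremal_polynomials[OF n x]) (rule that; blast)
  define \<Lambda> where "\<Lambda> = lambda_fun w n x"
  have \<alpha>0: "\<alpha> \<ge> 0" using functional_nonneg[OF K(2)] K(4) by simp
  have \<Lambda>0: "\<Lambda> \<ge> 0" "\<alpha> \<le> \<Lambda>" using \<alpha>0 \<alpha>(1) by (simp_all add: \<Lambda>_def)
  have W: "W > 0" using w_ge[of 1] m_pos R_pos by (simp add: W_def)
  have c: "c \<ge> 0" using R_pos m_pos by (simp add: c_def)
  have C: "C \<ge> 2 * c" "C \<ge> 1184 * W / m" using c W m_pos by (simp_all add: C_def)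
  have "c * (functional P - integral {-1..x} w) \<le> c * \<Lambda>"
    using \<alpha>(2) \<Lambda>0(2) c by (intro mult_left_mono) auto
  then have dil: "(x - e) * (p - w x) \<le> c * \<Lambda>" if "\<bar>e\<bar> = 1" for e
    using pi_fun_derivative_dilation[OF n x P(1-4) that d] by (simp add: c_def)
  have "- (c * \<Lambda>) / (1 - x) \<le> p - w x"
  proof (subst pos_divide_le_eq)
    show "- (c * \<Lambda>) \<le> (p - w x) * (1 - x)" using dil[of 1] by (simp add: algebra_simps)
  qed (use x in auto)
  moreover have "c * \<Lambda> \<le> C * \<Lambda>" using C(1) c \<Lambda>0 by (intro mult_right_mono) auto
  then have "- (C * \<Lambda>) / (1 - x) \<le> - (c * \<Lambda>) / (1 - x)"
    using x by (intro divide_right_mono) auto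
  ultimately show "- C * lambda_fun w n x / (1 - x) \<le> p - w x"
    by (simp add: \<Lambda>_def)
  show "p - w x \<le> C * lambda_fun w n x * min (1 / (1 + x)) (real n ^ 2)"
  proof (cases "2 * real n ^ 2 * (1 + x) \<le> 1")
    case False
    have "p - w x \<le> c * \<Lambda> / (1 + x)"
    proof (subst pos_le_divide_eq)
      show "(p - w x) * (1 + x) \<le> c * \<Lambda>" using dil[of "-1"] by (simp add: algebra_simps)
    qed (use x in auto)
    also have "\<dots> = c * \<Lambda> * (1 / (1 + x))" by simp
    \<comment> \<open>Away from the endpoint 1 / (1 + x) is below 2 n^2, hence comparable with the
      minimum.\<close>
    also have "1 / (1 + x) \<le> 2 * min (1 / (1 + x)) (real n ^ 2)"
    proof -
      have "1 / (1 + x) \<le> 2 * real n ^ 2"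
      proof (subst pos_divide_le_eq)
        show "1 \<le> 2 * real n ^ 2 * (1 + x)" using False by linarith
      qed (use x in auto)
      moreover have "1 / (1 + x) > 0" using x by simp
      ultimately show ?thesis unfolding min_def by (smt (verit))
    qed
    then have "c * \<Lambda> * (1 / (1 + x)) \<le> c * \<Lambda> * (2 * min (1 / (1 + x)) (real n ^ 2))"
      using c \<Lambda>0 by (intro mult_left_mono) auto
    also have "\<dots> = (2 * c) * (\<Lambda> * min (1 / (1 + x)) (real n ^ 2))" by simp
    also have "\<dots> \<le> C * (\<Lambda> * min (1 / (1 + x)) (real n ^ 2))"
      using C(1) \<Lambda>0 x by (intro mult_right_mono) auto
    finally show ?thesis by (simp add: \<Lambda>_def mult.assoc)
  next
    case True
    define N where "N = real n ^ 2"
    have N: "N \<ge> 1" using n by (simp add: N_def)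
    have P_nonneg: "poly P t \<ge> 0" if "t \<in> {-1..1}" for t
      using P(2)[of t] P(3)[of t] that by (cases "t \<le> x") force+
    \<comment> \<open>The Markov constant of \<open>P\<close>. The integral of \<open>P\<close> is
      O(1 / n^2) here: m times it is at most the integral of w over [-1,x] plus the mass \<alpha>,
      and both are of this size near -1.\<close>
    define L where "L = real (2 * n) ^ 4 * integral {-1..1} (poly P)"
    have "integral {-1..x} w \<le> integral {-1..x} (\<lambda>_. W)"
      using x w_integrable[of "-1" x] w_le by (intro integral_le) (auto simp: W_def)
    also have "\<dots> = (1 + x) * W" using x by simp
    finally have "m * integral {-1..1} (poly P) \<le> (1 + x) * W + \<alpha>"
      using functional_ge_integral[OF P_nonneg] \<alpha>(2) by linarith
    then have "N * (m * integral {-1..1} (poly P)) \<le> N * ((1 + x) * W + \<alpha>)"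
      using N by (intro mult_left_mono) auto
    also have "\<dots> = (N * (1 + x)) * W + \<alpha> * N" by (simp add: algebra_simps)
    also have "\<dots> \<le> 1 * W + 36 * W"
    proof (intro add_mono mult_right_mono)
      show "\<alpha> * N \<le> 36 * W"
        unfolding N_def W_def using x True \<alpha>0 \<alpha>(3) by (intro endpoint_mass_bound[OF n]) auto
      have "N * (1 + x) \<ge> 0" using N x by simp
      then show "N * (1 + x) \<le> 1" using True by (simp add: N_def)
    qed (use W in auto)
    finally have "N * integral {-1..1} (poly P) \<le> 37 * W / m"
      using m_pos by (simp add: pos_le_divide_eq ac_simps)
    then have "16 * N * (N * integral {-1..1} (poly P)) \<le> 16 * N * (37 * W / m)"
      using N by (intro mult_left_mono) auto
    moreover have "L = 16 * N * (N * integral {-1..1} (poly P))"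
      by (simp add: L_def N_def power_mult_distrib power2_eq_square power4_eq_xxxx)
    ultimately have L_le: "L \<le> 592 * W / m * N" by (simp add: ac_simps)
    have "p \<le> 2 * L * \<alpha>"
      unfolding K(4)[symmetric]
    proof (rule pi_fun_derivative_le_lipschitz[OF n x P K(1-3) _ _ d])
      have "integral {-1..1} (poly P) \<ge> 0"
        using P_nonneg by (intro integral_nonneg integrable_continuous_real continuous_intros)
      then show "L \<ge> 0" by (simp add: L_def)
      show "\<bar>poly P x - poly P t\<bar> \<le> L * \<bar>x - t\<bar>" if "t \<in> {-1..1}" for t
        unfolding L_def using x that P(1) P_nonneg by (intro poly_lipschitz_integral) auto
    qed
    also have "\<dots> \<le> 2 * (592 * W / m * N) * \<Lambda>"
      using L_le \<Lambda>0 \<alpha>0 N W m_pos by (intro mult_mono mult_left_mono) auto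
    also have "\<dots> = 1184 * W / m * (\<Lambda> * N)" by simp
    also have "\<dots> \<le> C * (\<Lambda> * N)"
      using C(2) \<Lambda>0 N by (intro mult_right_mono) auto
    finally have "p \<le> C * (\<Lambda> * N)" .
    moreover have "w x \<ge> 0" using w_ge[of x] m_pos x by simp
    \<comment> \<open>Near the endpoint the minimum is n^2, and the nonnegative w(x) may be
      discarded on the left.\<close>
    moreover have "N \<le> 1 / (1 + x)"
    proof -
      have "N * (1 + x) \<ge> 0" using N x by simp
      then have "N * (1 + x) \<le> 1" using True by (simp add: N_def)
      then show ?thesis using x by (simp add: pos_le_divide_eq)
    qed
    then have "min (1 / (1 + x)) (real n ^ 2) = N" by (simp add: N_def)
    ultimately show ?thesis by (simp add: \<Lambda>_def mult.assoc)
  qed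
qed

end

theorem theorem1p1:
  fixes w :: "real \<Rightarrow> real" and m R :: real
  assumes "m > 0" and "R > 0"
    and "\<forall>x\<in>{-1..1}. w x \<ge> m"
    and "\<forall>x y. -1 \<le> x \<and> x < y \<and> y \<le> 1 \<longrightarrow> \<bar>w x - w y\<bar> \<le> R * (y - x)"
  shows "\<exists>C > 0. \<forall>n :: nat. \<forall>x :: real. n \<ge> 1 \<and> -1 < x \<and> x < 1 \<and>
            pi_fun w n differentiable (at x) \<longrightarrow>
              - C * lambda_fun w n x / (1 - x) \<le> deriv (pi_fun w n) x - w x \<and>
              deriv (pi_fun w n) x - w x \<le>
                C * lambda_fun w n x * min (1 / (1 + x)) (real n ^ 2)"
proof -
  interpret lipschitz_weight w m R
  proof
    fix s t :: real assume st: "s \<in> {-1..1}" "t \<in> {-1..1}"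
    show "\<bar>w s - w t\<bar> \<le> R * \<bar>s - t\<bar>"
      using assms(4)[rule_format, of s t] assms(4)[rule_format, of t s] st
      by (cases s t rule: linorder_cases) (auto simp: abs_minus_commute)
  qed (use assms in auto)
  define C where "C = 2 * (1 + 2 * R / m) + 1184 * (w 1 + 2 * R) / m"
  have "w 1 \<ge> m" using assms(3) by auto
  then have "C > 0" using assms(1,2) by (simp add: C_def add_pos_nonneg)
  moreover have "- C * lambda_fun w n x / (1 - x) \<le> deriv (pi_fun w n) x - w x \<and>
      deriv (pi_fun w n) x - w x \<le> C * lambda_fun w n x * min (1 / (1 + x)) (real n ^ 2)"
    if "n \<ge> 1" "-1 < x" "x < 1" "pi_fun w n differentiable (at x)" for n x
  proof -
    have "(pi_fun w n has_real_derivative deriv (pi_fun w n) x) (at x)"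
      using that(4) DERIV_deriv_iff_real_differentiable by blast
    then show ?thesis
      unfolding C_def using that pi_fun_derivative_bounds[of n x] by simp
  qed
  ultimately show ?thesis by blast
qed

end
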